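(* Let $(A,* )$ and $(V,h)$ satisfy the standing assumptions in the context, and let $U$ be the unitary group of $(V,h)$. Suppose $\mathfrak{i}$ is a $*$-invariant nilpotent ideal of $A$. Let $\overline{U}$ be the unitary group of the reduction $(\overline{V},\overline{h})$ of $(V,h)$ modulo $\mathfrak{i}$. Then the canonical homomorphism $U\to\overline{U}$, $g\mapsto\overline{g}$, is surjective.
   Context: Standing assumptions. $A$ is a ring with identity, not necessarily commutative, with Jacobson radical $\mathfrak{r}$, which is local in the sense that $A/\mathfrak{r}$ is a division ring. $*$ is an involution of $A$, i.e. an anti-automorphism of order $\le 2$. The elements fixed by $*$ lie in the center of $A$; they form a local ring $R$ with Jacobson radical $\mathfrak{m}=R\cap\mathfrak{r}$. The residue field $R/\mathfrak{m}=F_q$ is a finite field of odd characteristic, and the squaring map $1+\mathfrak{m}\to 1+\mathfrak{m}$ is surjective. $V$ is a free right $A$-module of rank $m\geq1$ and $h:V\times V\to A$ is a non-degenerate $*$-hermitian form: $h$ is biadditive, $h(u,va)=h(u,v)a$, $h(v,u)=h(u,v)^*$, and $u\mapsto h(u,-)$ is an isomorphism from $V$ onto $V^*=\mathrm{Hom}_A(V,A)$, where $V^*$ is a right $A$-module via $(\alpha a)(v)=a^*\alpha(v)$. The unitary group $U$ of $(V,h)$ is the group of all $A$-linear automorphisms of $V$ preserving $h$. Reduction modulo a $*$-invariant ideal $\mathfrak{i}$: $\overline{A}=A/\mathfrak{i}$ with the induced involution, $\overline{V}=V/V\mathfrak{i}$ (free of rank $m$ over $\overline{A}$), and $\overline{h}(v+V\mathfrak{i},w+V\mathfrak{i})=h(v,w)+\mathfrak{i}$,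 a non-degenerate hermitian form. For $g\in U$, $\overline{g}\in\overline{U}$ is defined by $\overline{g}(v+V\mathfrak{i})=g(v)+V\mathfrak{i}$. *)

theory Defs
  imports "HOL-Algebra.QuotRing" "HOL-Algebra.Ideal_Product" "HOL-Algebra.Module"
    "HOL-Algebra.Bij" "HOL-Algebra.Generated_Groups" "HOL-Algebra.Elementary_Groups"
    "HOL-Algebra.Multiplicative_Group"
begin

section \<open>Local rings\<close>

definition right_ideal :: "'a set \<Rightarrow> ('a, 'c) ring_scheme \<Rightarrow> bool" where
  "right_ideal J A \<longleftrightarrow>
     additive_subgroup J A \<and> (\<forall>x\<in>J. \<forall>a\<in>carrier A. x \<otimes>\<^bsub>A\<^esub> a \<in> J)"

definition maximal_right_ideal :: "'a set \<Rightarrow> ('a, 'c) ring_scheme \<Rightarrow> bool" where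
  "maximal_right_ideal J A \<longleftrightarrow>
     right_ideal J A \<and> J \<noteq> carrier A \<and>
     (\<forall>K. right_ideal K A \<longrightarrow> J \<subseteq> K \<longrightarrow> K = J \<or> K = carrier A)"

(* Intersecting with the carrier only matters for the zero ring. *)
definition jacobson_radical :: "('a, 'c) ring_scheme \<Rightarrow> 'a set" where
  "jacobson_radical A = carrier A \<inter> \<Inter> {J. maximal_right_ideal J A}"

locale division_ring = ring D for D (structure) +
  assumes one_neq_zero: "\<one> \<noteq> \<zero>"
    and Units_eq: "Units D = carrier D - {\<zero>}"

locale local_ring = ring A for A (structure) +
  assumes residue_division_ring: "division_ring (A Quot (jacobson_radical A))"


section \<open>Rings with involution\<close>

locale involution_ring = ring A for A (structure) +
  fixes star :: "'a \<Rightarrow> 'a"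
  assumes star_closed: "a \<in> carrier A \<Longrightarrow> star a \<in> carrier A"
    and star_add: "a \<in> carrier A \<Longrightarrow> b \<in> carrier A \<Longrightarrow> star (a \<oplus> b) = star a \<oplus> star b"
    and star_mult: "a \<in> carrier A \<Longrightarrow> b \<in> carrier A \<Longrightarrow> star (a \<otimes> b) = star b \<otimes> star a"
    and star_star: "a \<in> carrier A \<Longrightarrow> star (star a) = a"

definition fixed_ring :: "('a, 'c) ring_scheme \<Rightarrow> ('a \<Rightarrow> 'a) \<Rightarrow> ('a, 'c) ring_scheme" where
  "fixed_ring A star = A\<lparr>carrier := {a \<in> carrier A. star a = a}\<rparr>"

locale local_involution_ring = local_ring A + involution_ring A star
  for A (structure) and star +
  assumes fixed_central:
      "r \<in> carrier (fixed_ring A star) \<Longrightarrow> a \<in> carrier A \<Longrightarrow> r \<otimes> a = a \<otimes> r"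
    and fixed_local: "local_ring (fixed_ring A star)"
    and fixed_radical:
      "jacobson_radical (fixed_ring A star)
         = carrier (fixed_ring A star) \<inter> jacobson_radical A"
    and residue_field:
      "field (fixed_ring A star Quot jacobson_radical (fixed_ring A star))"
    and residue_finite:
      "finite (carrier (fixed_ring A star Quot jacobson_radical (fixed_ring A star)))"
    (* the characteristic is the additive order of the identity *)
    and residue_odd_char:
      "odd (group.ord (add_monoid (fixed_ring A star Quot jacobson_radical (fixed_ring A star)))
              \<one>\<^bsub>fixed_ring A star Quot jacobson_radical (fixed_ring A star)\<^esub>)"
    and squaring_surj:
      "(\<lambda>x. x \<otimes> x) ` (jacobson_radical (fixed_ring A star) +> \<one>)
         = jacobson_radical (fixed_ring A star) +> \<one>"


section \<open>Right modules\<close>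

(* The library's module record is reused, with \<open>a \<odot>\<^bsub>V\<^esub> v\<close> standing for the right action v a. *)
locale right_module = A?: ring A + V?: abelian_group V
  for A :: "('a, 'c) ring_scheme" (structure) and V :: "('a, 'b, 'd) module_scheme" (structure) +
  assumes act_closed:
      "a \<in> carrier A \<Longrightarrow> v \<in> carrier V \<Longrightarrow> a \<odot>\<^bsub>V\<^esub> v \<in> carrier V"
    and act_add_scalar:
      "a \<in> carrier A \<Longrightarrow> b \<in> carrier A \<Longrightarrow> v \<in> carrier V \<Longrightarrow>
         (a \<oplus>\<^bsub>A\<^esub> b) \<odot>\<^bsub>V\<^esub> v = a \<odot>\<^bsub>V\<^esub> v \<oplus>\<^bsub>V\<^esub> b \<odot>\<^bsub>V\<^esub> v"
    and act_add_vector: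
      "a \<in> carrier A \<Longrightarrow> v \<in> carrier V \<Longrightarrow> w \<in> carrier V \<Longrightarrow>
         a \<odot>\<^bsub>V\<^esub> (v \<oplus>\<^bsub>V\<^esub> w) = a \<odot>\<^bsub>V\<^esub> v \<oplus>\<^bsub>V\<^esub> a \<odot>\<^bsub>V\<^esub> w"
    and act_mult:
      "a \<in> carrier A \<Longrightarrow> b \<in> carrier A \<Longrightarrow> v \<in> carrier V \<Longrightarrow>
         (a \<otimes>\<^bsub>A\<^esub> b) \<odot>\<^bsub>V\<^esub> v = b \<odot>\<^bsub>V\<^esub> (a \<odot>\<^bsub>V\<^esub> v)"
    and act_one: "v \<in> carrier V \<Longrightarrow> \<one>\<^bsub>A\<^esub> \<odot>\<^bsub>V\<^esub> v = v"

definition free_of_rank ::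
    "('a, 'c) ring_scheme \<Rightarrow> ('a, 'b, 'd) module_scheme \<Rightarrow> nat \<Rightarrow> bool" where
  "free_of_rank A V m \<longleftrightarrow>
     (\<exists>e \<in> {..<m} \<rightarrow> carrier V. \<forall>v\<in>carrier V.
        \<exists>!c. c \<in> ({..<m} \<rightarrow>\<^sub>E carrier A) \<and> v = (\<Oplus>\<^bsub>V\<^esub>i\<in>{..<m}. c i \<odot>\<^bsub>V\<^esub> e i))"

(* Homomorphisms are extensional, so that equality of maps is equality on the carrier. *)
definition linear_maps ::
    "('a, 'c) ring_scheme \<Rightarrow> ('a, 'b, 'd) module_scheme \<Rightarrow> ('a, 'e, 'f) module_scheme
       \<Rightarrow> ('b \<Rightarrow> 'e) set" where
  "linear_maps A V W =
     {f \<in> carrier V \<rightarrow>\<^sub>E carrier W.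
        (\<forall>v\<in>carrier V. \<forall>w\<in>carrier V. f (v \<oplus>\<^bsub>V\<^esub> w) = f v \<oplus>\<^bsub>W\<^esub> f w) \<and>
        (\<forall>a\<in>carrier A. \<forall>v\<in>carrier V. f (a \<odot>\<^bsub>V\<^esub> v) = a \<odot>\<^bsub>W\<^esub> f v)}"

(* A as a right module over itself *)
definition regular_module :: "('a, 'c) ring_scheme \<Rightarrow> ('a, 'a) module" where
  "regular_module A =
     \<lparr>carrier = carrier A, mult = undefined, one = undefined,
      zero = \<zero>\<^bsub>A\<^esub>, add = (\<oplus>\<^bsub>A\<^esub>), smult = (\<lambda>a x. x \<otimes>\<^bsub>A\<^esub> a)\<rparr>"

definition dual_module ::
    "('a, 'c) ring_scheme \<Rightarrow> ('a \<Rightarrow> 'a) \<Rightarrow> ('a, 'b, 'd) module_scheme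
       \<Rightarrow> ('a, 'b \<Rightarrow> 'a) module" where
  "dual_module A star V =
     \<lparr>carrier = linear_maps A V (regular_module A), mult = undefined, one = undefined,
      zero = (\<lambda>v\<in>carrier V. \<zero>\<^bsub>A\<^esub>),
      add = (\<lambda>\<alpha> \<beta>. \<lambda>v\<in>carrier V. \<alpha> v \<oplus>\<^bsub>A\<^esub> \<beta> v),
      smult = (\<lambda>a \<alpha>. \<lambda>v\<in>carrier V. star a \<otimes>\<^bsub>A\<^esub> \<alpha> v)\<rparr>"


section \<open>Hermitian forms and unitary groups\<close>

locale hermitian_space = involution_ring A star + right_module A V
  for A :: "('a, 'c) ring_scheme" (structure) and star
    and V :: "('a, 'b, 'd) module_scheme" (structure) +
  fixes h :: "'b \<Rightarrow> 'b \<Rightarrow> 'a" and m :: nat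
  assumes free: "free_of_rank A V m"
    and rank_pos: "m \<ge> 1"
    and h_closed: "u \<in> carrier V \<Longrightarrow> v \<in> carrier V \<Longrightarrow> h u v \<in> carrier A"
    and h_add_left:
      "u \<in> carrier V \<Longrightarrow> v \<in> carrier V \<Longrightarrow> w \<in> carrier V \<Longrightarrow>
         h (u \<oplus>\<^bsub>V\<^esub> v) w = h u w \<oplus>\<^bsub>A\<^esub> h v w"
    and h_add_right:
      "u \<in> carrier V \<Longrightarrow> v \<in> carrier V \<Longrightarrow> w \<in> carrier V \<Longrightarrow>
         h u (v \<oplus>\<^bsub>V\<^esub> w) = h u v \<oplus>\<^bsub>A\<^esub> h u w"
    and h_act_right:
      "u \<in> carrier V \<Longrightarrow> v \<in> carrier V \<Longrightarrow> a \<in> carrier A \<Longrightarrow>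
         h u (a \<odot>\<^bsub>V\<^esub> v) = h u v \<otimes>\<^bsub>A\<^esub> a"
    and h_hermitian:
      "u \<in> carrier V \<Longrightarrow> v \<in> carrier V \<Longrightarrow> h v u = star (h u v)"
    and h_nondegenerate_linear:
      "(\<lambda>u\<in>carrier V. \<lambda>v\<in>carrier V. h u v) \<in> linear_maps A V (dual_module A star V)"
    and h_nondegenerate_bij:
      "bij_betw (\<lambda>u\<in>carrier V. \<lambda>v\<in>carrier V. h u v)
         (carrier V) (carrier (dual_module A star V))"

definition unitary_group ::
    "('a, 'c) ring_scheme \<Rightarrow> ('a, 'b, 'd) module_scheme \<Rightarrow> ('b \<Rightarrow> 'b \<Rightarrow> 'a)
       \<Rightarrow> ('b \<Rightarrow> 'b) monoid" where
  "unitary_group A V h =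
     BijGroup (carrier V)
       \<lparr>carrier := {g \<in> Bij (carrier V). g \<in> linear_maps A V V \<and>
          (\<forall>u\<in>carrier V. \<forall>v\<in>carrier V. h (g u) (g v) = h u v)}\<rparr>"


section \<open>Reduction modulo an ideal\<close>

definition nilpotent_ideal :: "'a set \<Rightarrow> ('a, 'c) ring_scheme \<Rightarrow> bool" where
  "nilpotent_ideal I A \<longleftrightarrow>
     ideal I A \<and> (\<exists>n. (ideal_prod A I ^^ n) (carrier A) = {\<zero>\<^bsub>A\<^esub>})"

(* The submodule V I, consisting of the finite sums of elements v a with a in I. *)
definition module_ideal_prod ::
    "('a, 'b, 'd) module_scheme \<Rightarrow> 'a set \<Rightarrow> 'b set" where
  "module_ideal_prod V I = generate (add_monoid V) {a \<odot>\<^bsub>V\<^esub> v |a v. a \<in> I \<and> v \<in> carrier V}"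

(* As in the library's factor rings, operations on cosets are unions over all representatives. *)
definition reduced_module ::
    "('a, 'b, 'd) module_scheme \<Rightarrow> 'a set \<Rightarrow> ('a set, 'b set) module" where
  "reduced_module V I =
     \<lparr>carrier = a_rcosets\<^bsub>V\<^esub> (module_ideal_prod V I), mult = undefined, one = undefined,
      zero = module_ideal_prod V I, add = set_add V,
      smult = (\<lambda>S X. \<Union>a\<in>S. \<Union>v\<in>X. module_ideal_prod V I +>\<^bsub>V\<^esub> (a \<odot>\<^bsub>V\<^esub> v))\<rparr>"

definition reduced_form ::
    "('a, 'c) ring_scheme \<Rightarrow> 'a set \<Rightarrow> ('b \<Rightarrow> 'b \<Rightarrow> 'a) \<Rightarrow> 'b set \<Rightarrow> 'b set \<Rightarrow> 'a set" where
  "reduced_form A I h = (\<lambda>X Y. \<Union>v\<in>X. \<Union>w\<in>Y. I +>\<^bsub>A\<^esub> h v w)"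

definition reduced_map ::
    "('a, 'b, 'd) module_scheme \<Rightarrow> 'a set \<Rightarrow> ('b \<Rightarrow> 'b) \<Rightarrow> 'b set \<Rightarrow> 'b set" where
  "reduced_map V I g =
     (\<lambda>X\<in>carrier (reduced_module V I). \<Union>v\<in>X. module_ideal_prod V I +>\<^bsub>V\<^esub> g v)"

end

theory Submission
  imports Defs
begin

text \<open>
  An isometry of the reduction is lifted in two stages. First, \<open>V\<close> is free, so any linear map of
  \<open>V / V I\<close> lifts to a linear map \<open>g\<close> of \<open>V\<close> (\<open>linear_lift\<close>); if the given map preserves the reduced
  form, then \<open>D(u, v) = h (g u) (g v) - h u v\<close> lies in \<open>I\<close> for all \<open>u\<close> and \<open>v\<close>.

  Secondly, the error \<open>D\<close> is removed by Newton's method. Suppose that \<open>D\<close> takes values in an ideal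
  \<open>J\<close> with \<open>star ` J \<subseteq> J\<close>. Nondegeneracy of \<open>h\<close> gives a linear map \<open>y\<close> from \<open>V\<close> to \<open>V J\<close> with
  \<open>h (y u) v = - D(u, v) / 2\<close>, and the defect of \<open>g (1 + y)\<close> takes values in \<open>J\<^sup>2\<close>
  (\<open>correction_step\<close>). As \<open>I\<close> is nilpotent, finitely many steps starting from \<open>J = I\<close> produce a map
  \<open>f\<close> that preserves \<open>h\<close> exactly and agrees with \<open>g\<close> modulo \<open>V I\<close> (\<open>isometry_near\<close>). It is
  injective by nondegeneracy, and surjective by Nakayama's argument, since its reduction is
  (\<open>surjective_of_surjective_mod\<close>).

  The division by \<open>2\<close> is the only place where the ring \<open>R\<close> of fixed elements enters. Its residue
  field has odd characteristic and \<open>R\<close> lies in the center, so \<open>2\<close> has an inverse that is central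
  and fixed by the involution (\<open>central_half\<close>).

  Throughout, \<open>V J\<close> stands for \<open>module_ideal_prod V J\<close>, and comments write scalars on the right of
  vectors, \<open>v a\<close> for \<open>a \<odot>\<^bsub>V\<^esub> v\<close>.
\<close>

section \<open>Inverting two in the fixed ring\<close>

text \<open>Zorn's lemma. Properness is expressed by \<open>\<one> \<notin> K\<close>, which survives unions of chains.\<close>
lemma (in ring) proper_right_ideal_in_maximal:
  assumes J: "right_ideal J R" and proper: "J \<noteq> carrier R"
  shows "\<exists>P. maximal_right_ideal P R \<and> J \<subseteq> P"
proof -
  define S where "S = {K. right_ideal K R \<and> J \<subseteq> K \<and> \<one> \<notin> K}"
  have full: "K = carrier R" if K: "right_ideal K R" and 1: "\<one> \<in> K" for K
  proof -
    have "x \<in> K" if "x \<in> carrier R" for x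
      using K 1 that unfolding right_ideal_def by (metis l_one)
    moreover have "K \<subseteq> carrier R"
      using K unfolding right_ideal_def by (meson additive_subgroup.a_subset)
    ultimately show ?thesis by blast
  qed
  have "J \<in> S"
    using J proper full unfolding S_def by blast
  have "\<exists>M\<in>S. \<forall>X\<in>S. M \<subseteq> X \<longrightarrow> X = M"
  proof (rule subset_Zorn_nonempty)
    show "S \<noteq> {}" using \<open>J \<in> S\<close> by blast
    fix C assume C: "C \<noteq> {}" "subset.chain S C"
    have CS: "C \<subseteq> S" and lin: "\<And>X Y. X \<in> C \<Longrightarrow> Y \<in> C \<Longrightarrow> X \<subseteq> Y \<or> Y \<subseteq> X"
      using C(2) by (auto simp: subset.chain_def)
    have sub: "subgroup K (add_monoid R)" if "K \<in> C" for K
      using CS that unfolding S_def right_ideal_def additive_subgroup_def by blast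
    have "subgroup (\<Union>C) (add_monoid R)"
    proof (rule add.subgroupI)
      show "\<Union>C \<subseteq> carrier R"
        using subgroup.subset[OF sub] by auto
      show "\<Union>C \<noteq> {}"
        using C(1) subgroup.one_closed[OF sub] by auto
      show "\<ominus> a \<in> \<Union>C" if "a \<in> \<Union>C" for a
        using that subgroup.m_inv_closed[OF sub] unfolding a_inv_def by auto
      show "a \<oplus> b \<in> \<Union>C" if "a \<in> \<Union>C" "b \<in> \<Union>C" for a b
      proof -
        obtain X Y where "a \<in> X" "X \<in> C" "b \<in> Y" "Y \<in> C" using \<open>a \<in> \<Union>C\<close> \<open>b \<in> \<Union>C\<close> by blast
        then obtain Z where "a \<in> Z" "b \<in> Z" "Z \<in> C" using lin[of X Y] by blast
        then show ?thesis using subgroup.m_closed[OF sub, of Z a b] by auto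
      qed
    qed
    moreover have "x \<otimes> a \<in> \<Union>C" if "x \<in> \<Union>C" "a \<in> carrier R" for x a
      using that CS unfolding S_def right_ideal_def by blast
    moreover have "J \<subseteq> \<Union>C" "\<one> \<notin> \<Union>C"
      using C(1) CS unfolding S_def by blast+
    ultimately show "\<Union>C \<in> S"
      unfolding S_def right_ideal_def by (simp add: additive_subgroup_def)
  qed
  then obtain P where P: "P \<in> S" and max: "\<And>X. X \<in> S \<Longrightarrow> P \<subseteq> X \<Longrightarrow> X = P" by blast
  have "K = P \<or> K = carrier R" if "right_ideal K R" "P \<subseteq> K" for K
    using that P max[of K] full[of K] unfolding S_def by blast
  moreover have "P \<noteq> carrier R" using P unfolding S_def by auto
  ultimately show ?thesis
    using P unfolding S_def maximal_right_ideal_def by blast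
qed

lemma (in cring) jacobson_radical_ideal: "ideal (jacobson_radical R) R"
proof (rule idealI)
  show "ring R" by unfold_locales
  have sub: "subgroup P (add_monoid R)" if "maximal_right_ideal P R" for P
    using that unfolding maximal_right_ideal_def right_ideal_def additive_subgroup_def by blast
  show "subgroup (jacobson_radical R) (add_monoid R)"
  proof (rule add.subgroupI)
    show "jacobson_radical R \<subseteq> carrier R" by (auto simp: jacobson_radical_def)
    have "\<zero> \<in> jacobson_radical R"
      using subgroup.one_closed[OF sub] by (auto simp: jacobson_radical_def)
    then show "jacobson_radical R \<noteq> {}" by blast
    show "\<ominus> a \<in> jacobson_radical R" if "a \<in> jacobson_radical R" for a
      using that subgroup.m_inv_closed[OF sub, of _ a]
      by (auto simp: jacobson_radical_def a_inv_def[symmetric])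
    show "a \<oplus> b \<in> jacobson_radical R"
      if "a \<in> jacobson_radical R" "b \<in> jacobson_radical R" for a b
      using that subgroup.m_closed[OF sub, of _ a b] by (auto simp: jacobson_radical_def)
  qed
  show r: "a \<otimes> x \<in> jacobson_radical R"
    if "a \<in> jacobson_radical R" "x \<in> carrier R" for a x
    using that unfolding jacobson_radical_def maximal_right_ideal_def right_ideal_def by auto
  show "x \<otimes> a \<in> jacobson_radical R"
    if "a \<in> jacobson_radical R" "x \<in> carrier R" for a x
    using r[OF that] that by (simp add: m_comm jacobson_radical_def)
qed

text \<open>The residue field has odd characteristic, so \<open>2\<close> is nonzero there and hence invertible
  modulo the radical. If \<open>2\<close> were not invertible, it would lie in a maximal ideal; since the
  radical lies in that ideal as well, so would \<open>1\<close>.\<close>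
lemma (in cring) two_invertible:
  assumes field: "field (R Quot jacobson_radical R)"
    and odd: "odd (group.ord (add_monoid (R Quot jacobson_radical R))
                \<one>\<^bsub>R Quot jacobson_radical R\<^esub>)"
  shows "\<exists>c\<in>carrier R. c \<oplus> c = \<one>"
proof (rule ccontr)
  assume no: "\<not> ?thesis"
  define M where "M = jacobson_radical R"
  interpret M: ideal M R unfolding M_def by (rule jacobson_radical_ideal)
  interpret Q: field "R Quot M" using field by (simp add: M_def)
  interpret \<pi>: ring_hom_ring R "R Quot M" "(+>) M" by (rule M.rcos_ring_hom_ring)
  define J where "J = (\<lambda>c. c \<oplus> c) ` carrier R"
  have "subgroup J (add_monoid R)"
  proof (rule add.subgroupI)
    show "J \<subseteq> carrier R" "J \<noteq> {}" by (auto simp: J_def)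
    show "\<ominus> a \<in> J" if a: "a \<in> J" for a
    proof -
      obtain x where x: "x \<in> carrier R" "a = x \<oplus> x" using a by (auto simp: J_def)
      then have "\<ominus> a = (\<ominus> x) \<oplus> (\<ominus> x)" by (simp add: minus_add)
      with x(1) show ?thesis by (auto simp: J_def)
    qed
    show "a \<oplus> b \<in> J" if a: "a \<in> J" and b: "b \<in> J" for a b
    proof -
      obtain x y where x: "x \<in> carrier R" "a = x \<oplus> x" "y \<in> carrier R" "b = y \<oplus> y"
        using a b by (auto simp: J_def)
      then have "a \<oplus> b = (x \<oplus> y) \<oplus> (x \<oplus> y)" by algebra
      with x show ?thesis by (auto simp: J_def)
    qed
  qed
  moreover have "a \<otimes> b \<in> J" if "a \<in> J" "b \<in> carrier R" for a b
    using that by (auto simp: J_def l_distr)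
  ultimately have "right_ideal J R"
    by (auto simp: right_ideal_def additive_subgroup_def)
  moreover have "J \<noteq> carrier R"
    using no by (force simp: J_def)
  ultimately obtain P where P: "maximal_right_ideal P R" and JP: "J \<subseteq> P"
    using proper_right_ideal_in_maximal by blast
  have MP: "M \<subseteq> P" using P by (auto simp: M_def jacobson_radical_def)
  have 1: "\<one> \<notin> P"
  proof
    assume "\<one> \<in> P"
    then have "carrier R \<subseteq> P"
      using P unfolding maximal_right_ideal_def right_ideal_def by (metis l_one subsetI)
    moreover have "P \<subseteq> carrier R"
      using P unfolding maximal_right_ideal_def right_ideal_def
      by (meson additive_subgroup.a_subset)
    ultimately show False using P unfolding maximal_right_ideal_def by blast
  qed
  interpret P: additive_subgroup P R
    using P unfolding maximal_right_ideal_def right_ideal_def by blast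
  let ?t = "\<one> \<oplus> \<one>" and ?u = "\<one>\<^bsub>R Quot M\<^esub>"
  have t: "M +> ?t = ?u \<oplus>\<^bsub>R Quot M\<^esub> ?u" by simp
  have "M +> ?t \<noteq> \<zero>\<^bsub>R Quot M\<^esub>"
  proof
    assume "M +> ?t = \<zero>\<^bsub>R Quot M\<^esub>"
    then have "?u \<oplus>\<^bsub>R Quot M\<^esub> ?u = \<zero>\<^bsub>R Quot M\<^esub>" using t by simp
    then have "?u [^]\<^bsub>add_monoid (R Quot M)\<^esub> (2::nat) = \<one>\<^bsub>add_monoid (R Quot M)\<^esub>"
      by (simp add: numeral_2_eq_2)
    then have "group.ord (add_monoid (R Quot M)) ?u dvd 2"
      using group.pow_eq_id[OF Q.a_group, of ?u 2] by simp
    moreover have "n = 1" if "n dvd 2" "odd n" for n :: nat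
      using dvd_imp_le[OF that(1)] that(2) by (cases "n = 2") (auto simp: le_Suc_eq numeral_2_eq_2)
    ultimately have "group.ord (add_monoid (R Quot M)) ?u = 1"
      using odd unfolding M_def by blast
    then have "?u = \<zero>\<^bsub>R Quot M\<^esub>"
      using group.ord_eq_1[OF Q.a_group, of ?u] by simp
    then show False by simp
  qed
  then have "M +> ?t \<in> Units (R Quot M)"
    using Q.field_Units \<pi>.hom_closed[of ?t] by auto
  then obtain Y where Y: "Y \<in> carrier (R Quot M)" "(M +> ?t) \<otimes>\<^bsub>R Quot M\<^esub> Y = ?u"
    using Q.Units_r_inv_ex by blast
  from Y(1) obtain s where s: "s \<in> carrier R" "Y = M +> s"
    unfolding FactRing_def A_RCOSETS_def' by auto
  have "M +> (?t \<otimes> s) = (M +> ?t) \<otimes>\<^bsub>R Quot M\<^esub> (M +> s)"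
    by (rule \<pi>.hom_mult) (use s in simp_all)
  also have "\<dots> = M +> \<one>" using Y(2) s(2) \<pi>.hom_one by simp
  finally have eq: "M +> (?t \<otimes> s) = M +> \<one>" .
  have "?t \<otimes> s \<in> M +> \<one>"
    using M.a_rcos_self[of "?t \<otimes> s"] s(1) eq by simp
  then have "?t \<otimes> s \<ominus> \<one> \<in> P"
    using M.a_rcos_module_minus[OF ring_axioms, of \<one> "?t \<otimes> s"] s(1) MP by auto
  moreover have "?t \<otimes> s \<in> P"
    using s JP by (auto simp: J_def l_distr)
  ultimately have "?t \<otimes> s \<oplus> \<ominus> (?t \<otimes> s \<ominus> \<one>) \<in> P" by blast
  moreover have "?t \<otimes> s \<oplus> \<ominus> (?t \<otimes> s \<ominus> \<one>) = \<one>"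
    using s(1) by (simp add: a_minus_def minus_add r_neg2 del: l_distr)
  ultimately show False using 1 by simp
qed

text \<open>The fixed ring is commutative because its elements are central. Half of the identity, found there,
  is central and fixed by the involution, as the correction of a linear map below requires.\<close>
lemma (in local_involution_ring) central_half:
  obtains c where "c \<in> carrier A" "star c = c" "c \<oplus> c = \<one>"
    "\<And>a. a \<in> carrier A \<Longrightarrow> c \<otimes> a = a \<otimes> c"
proof -
  let ?F = "fixed_ring A star"
  interpret F: local_ring ?F by (rule fixed_local)
  have "cring ?F"
  proof (rule cring.intro)
    show "ring ?F" by unfold_locales
    show "Group.comm_monoid ?F"
      using fixed_central
      by (intro Group.comm_monoid.intro Group.comm_monoid_axioms.intro F.monoid_axioms)
        (auto simp: fixed_ring_def)
  qed
  then obtain c where c: "c \<in> carrier ?F" "c \<oplus>\<^bsub>?F\<^esub> c = \<one>\<^bsub>?F\<^esub>"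
    using cring.two_invertible[OF _ residue_field residue_odd_char] by blast
  show thesis
  proof (rule that)
    show "c \<in> carrier A" "star c = c" "c \<oplus> c = \<one>" using c by (auto simp: fixed_ring_def)
    show "c \<otimes> a = a \<otimes> c" if "a \<in> carrier A" for a using fixed_central c that by blast
  qed
qed

section \<open>Right modules and products with ideals\<close>

context right_module
begin

lemma zero_act: "v \<in> carrier V \<Longrightarrow> \<zero>\<^bsub>A\<^esub> \<odot>\<^bsub>V\<^esub> v = \<zero>\<^bsub>V\<^esub>"
  using act_add_scalar[of \<zero> \<zero> v] act_closed[of \<zero> v] by (simp add: V.add.l_cancel_one)

lemma act_zero: "a \<in> carrier A \<Longrightarrow> a \<odot>\<^bsub>V\<^esub> \<zero>\<^bsub>V\<^esub> = \<zero>\<^bsub>V\<^esub>"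
  using act_add_vector[of a "\<zero>\<^bsub>V\<^esub>" "\<zero>\<^bsub>V\<^esub>"] act_closed[of a "\<zero>\<^bsub>V\<^esub>"]
  by (simp add: V.add.l_cancel_one)

lemma minus_act:
  assumes "a \<in> carrier A" "v \<in> carrier V"
  shows "(\<ominus>\<^bsub>A\<^esub> a) \<odot>\<^bsub>V\<^esub> v = \<ominus>\<^bsub>V\<^esub> (a \<odot>\<^bsub>V\<^esub> v)"
proof (rule V.minus_equality[symmetric])
  show "(\<ominus>\<^bsub>A\<^esub> a) \<odot>\<^bsub>V\<^esub> v \<oplus>\<^bsub>V\<^esub> a \<odot>\<^bsub>V\<^esub> v = \<zero>\<^bsub>V\<^esub>"
    using assms act_add_scalar[of "\<ominus>\<^bsub>A\<^esub> a" a v] by (simp add: A.l_neg zero_act)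
qed (use assms act_closed in auto)

lemma module_ideal_prod_subgroup:
  assumes "ideal J A"
  shows "subgroup (module_ideal_prod V J) (add_monoid V)"
  unfolding module_ideal_prod_def
  by (rule V.add.generate_is_subgroup) (use ideal.Icarr[OF assms] act_closed in auto)

lemma module_ideal_prod_carrier:
  assumes "ideal J A" "w \<in> module_ideal_prod V J"
  shows "w \<in> carrier V"
  using subgroup.subset[OF module_ideal_prod_subgroup[OF assms(1)]] assms(2) by auto

lemma module_ideal_prod_act:
  "a \<in> J \<Longrightarrow> v \<in> carrier V \<Longrightarrow> a \<odot>\<^bsub>V\<^esub> v \<in> module_ideal_prod V J"
  unfolding module_ideal_prod_def by (rule generate.incl) blast

lemma module_ideal_prod_add:
  "v \<in> module_ideal_prod V J \<Longrightarrow> w \<in> module_ideal_prod V J \<Longrightarrow>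
     v \<oplus>\<^bsub>V\<^esub> w \<in> module_ideal_prod V J"
  unfolding module_ideal_prod_def using generate.eng[of v "add_monoid V" _ w] by simp

lemma module_ideal_prod_zero: "\<zero>\<^bsub>V\<^esub> \<in> module_ideal_prod V J"
  unfolding module_ideal_prod_def using generate.one[of "add_monoid V"] by simp

lemma module_ideal_prod_mono:
  "J \<subseteq> K \<Longrightarrow> module_ideal_prod V J \<subseteq> module_ideal_prod V K"
  unfolding module_ideal_prod_def by (rule V.add.mono_generate) blast

text \<open>An ideal is closed under negation, so the inverses among the generators contribute
  nothing new.\<close>
lemma module_ideal_prod_induct [consumes 2, case_names zero act add]:
  assumes J: "ideal J A" and w: "w \<in> module_ideal_prod V J"
    and zero: "P \<zero>\<^bsub>V\<^esub>"
    and act: "\<And>a v. a \<in> J \<Longrightarrow> v \<in> carrier V \<Longrightarrow> P (a \<odot>\<^bsub>V\<^esub> v)"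
    and add: "\<And>v w. v \<in> module_ideal_prod V J \<Longrightarrow> w \<in> module_ideal_prod V J \<Longrightarrow>
                P v \<Longrightarrow> P w \<Longrightarrow> P (v \<oplus>\<^bsub>V\<^esub> w)"
  shows "P w"
  using w unfolding module_ideal_prod_def
proof (induction rule: generate.induct)
  case one
  show ?case using zero by simp
next
  case (incl h)
  then show ?case using act by blast
next
  case (inv h)
  then obtain a v where h: "h = a \<odot>\<^bsub>V\<^esub> v" "a \<in> J" "v \<in> carrier V" by blast
  then have "inv\<^bsub>add_monoid V\<^esub> h = (\<ominus>\<^bsub>A\<^esub> a) \<odot>\<^bsub>V\<^esub> v"
    using minus_act ideal.Icarr[OF J] by (simp add: a_inv_def)
  moreover have "\<ominus>\<^bsub>A\<^esub> a \<in> J"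
    using J h(2) by (simp add: additive_subgroup.a_inv_closed ideal.axioms(1))
  ultimately show ?case using act h(3) by simp
next
  case (eng h1 h2)
  then show ?case using add unfolding module_ideal_prod_def by simp
qed

lemma module_ideal_prod_act_closed:
  assumes J: "ideal J A" and w: "w \<in> module_ideal_prod V J" and b: "b \<in> carrier A"
  shows "b \<odot>\<^bsub>V\<^esub> w \<in> module_ideal_prod V J"
  using J w
proof (induction rule: module_ideal_prod_induct)
  case zero
  show ?case using act_zero[OF b] module_ideal_prod_zero by simp
next
  case (act a v)
  then have "b \<odot>\<^bsub>V\<^esub> (a \<odot>\<^bsub>V\<^esub> v) = (a \<otimes>\<^bsub>A\<^esub> b) \<odot>\<^bsub>V\<^esub> v"
    using act_mult b ideal.Icarr[OF J] by simp
  then show ?case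
    using module_ideal_prod_act ideal.I_r_closed[OF J] act b by simp
next
  case (add v w)
  then show ?case
    using act_add_vector[OF b] module_ideal_prod_carrier[OF J] module_ideal_prod_add by simp
qed

lemma finsum_in_module_ideal_prod:
  assumes "finite F" "\<And>i. i \<in> F \<Longrightarrow> a i \<in> J" "\<And>i. i \<in> F \<Longrightarrow> e i \<in> carrier V" "J \<subseteq> carrier A"
  shows "(\<Oplus>\<^bsub>V\<^esub>i\<in>F. a i \<odot>\<^bsub>V\<^esub> e i) \<in> module_ideal_prod V J"
  using assms(1-3)
proof (induction rule: finite_induct)
  case empty
  show ?case using module_ideal_prod_zero by simp
next
  case (insert i F)
  then have "(\<lambda>i. a i \<odot>\<^bsub>V\<^esub> e i) \<in> F \<rightarrow> carrier V" "a i \<odot>\<^bsub>V\<^esub> e i \<in> carrier V"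
    using assms(4) by (auto intro!: act_closed)
  then show ?case
    using insert module_ideal_prod_act module_ideal_prod_add by simp
qed

lemma linear_mapsD:
  assumes "f \<in> linear_maps A V W"
  shows "v \<in> carrier V \<Longrightarrow> f v \<in> carrier W"
    and "v \<in> carrier V \<Longrightarrow> w \<in> carrier V \<Longrightarrow> f (v \<oplus>\<^bsub>V\<^esub> w) = f v \<oplus>\<^bsub>W\<^esub> f w"
    and "a \<in> carrier A \<Longrightarrow> v \<in> carrier V \<Longrightarrow> f (a \<odot>\<^bsub>V\<^esub> v) = a \<odot>\<^bsub>W\<^esub> f v"
    and "f \<in> extensional (carrier V)"
  using assms by (auto simp: linear_maps_def PiE_iff)

lemma functionalD:
  assumes "\<phi> \<in> linear_maps A V (regular_module A)"
  shows "v \<in> carrier V \<Longrightarrow> \<phi> v \<in> carrier A"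
    and "v \<in> carrier V \<Longrightarrow> w \<in> carrier V \<Longrightarrow> \<phi> (v \<oplus>\<^bsub>V\<^esub> w) = \<phi> v \<oplus>\<^bsub>A\<^esub> \<phi> w"
    and "a \<in> carrier A \<Longrightarrow> v \<in> carrier V \<Longrightarrow> \<phi> (a \<odot>\<^bsub>V\<^esub> v) = \<phi> v \<otimes>\<^bsub>A\<^esub> a"
  using linear_mapsD[OF assms] by (auto simp: regular_module_def)

lemma functionalI:
  assumes "\<phi> \<in> extensional (carrier V)"
    and "\<And>v. v \<in> carrier V \<Longrightarrow> \<phi> v \<in> carrier A"
    and "\<And>v w. v \<in> carrier V \<Longrightarrow> w \<in> carrier V \<Longrightarrow> \<phi> (v \<oplus>\<^bsub>V\<^esub> w) = \<phi> v \<oplus>\<^bsub>A\<^esub> \<phi> w"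
    and "\<And>a v. a \<in> carrier A \<Longrightarrow> v \<in> carrier V \<Longrightarrow> \<phi> (a \<odot>\<^bsub>V\<^esub> v) = \<phi> v \<otimes>\<^bsub>A\<^esub> a"
  shows "\<phi> \<in> linear_maps A V (regular_module A)"
  using assms by (auto simp: linear_maps_def regular_module_def PiE_iff)

lemma functional_zero:
  assumes "\<phi> \<in> linear_maps A V (regular_module A)"
  shows "\<phi> \<zero>\<^bsub>V\<^esub> = \<zero>\<^bsub>A\<^esub>"
  using functionalD(3)[OF assms, of \<zero> "\<zero>\<^bsub>V\<^esub>"] functionalD(1)[OF assms, of "\<zero>\<^bsub>V\<^esub>"]
  by (simp add: zero_act)

text \<open>Scalars act on the right, so a functional moves the factor from \<open>J\<close> to the right.\<close>
lemma functional_ideal_prod: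
  assumes \<phi>: "\<phi> \<in> linear_maps A V (regular_module A)"
    and K: "\<And>v. v \<in> carrier V \<Longrightarrow> \<phi> v \<in> K" "ideal K A"
    and J: "ideal J A" and w: "w \<in> module_ideal_prod V J"
  shows "\<phi> w \<in> ideal_prod A K J"
  using J w
proof (induction rule: module_ideal_prod_induct)
  case zero
  have "\<zero> \<in> ideal_prod A K J"
    using A.ideal_prod_is_ideal[OF K(2) J] by (simp add: additive_subgroup.zero_closed ideal.axioms(1))
  then show ?case using functional_zero[OF \<phi>] by simp
next
  case (act a v)
  then show ?case
    using functionalD(3)[OF \<phi>] K(1) ideal.Icarr[OF J] by (simp add: ideal_prod.prod)
next
  case (add v w)
  then show ?case
    using functionalD(2)[OF \<phi>] module_ideal_prod_carrier[OF J] by (simp add: ideal_prod.sum)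
qed

lemma linear_map_zero:
  assumes g: "g \<in> linear_maps A V V"
  shows "g \<zero>\<^bsub>V\<^esub> = \<zero>\<^bsub>V\<^esub>"
  using linear_mapsD(3)[OF g, of \<zero> "\<zero>\<^bsub>V\<^esub>"] linear_mapsD(1)[OF g, of "\<zero>\<^bsub>V\<^esub>"]
  by (simp add: zero_act)

lemma linear_map_module_ideal_prod:
  assumes g: "g \<in> linear_maps A V V" and J: "ideal J A" and w: "w \<in> module_ideal_prod V J"
  shows "g w \<in> module_ideal_prod V J"
  using J w
proof (induction rule: module_ideal_prod_induct)
  case zero
  show ?case using linear_map_zero[OF g] module_ideal_prod_zero by simp
next
  case (act a v)
  then show ?case
    using linear_mapsD[OF g] ideal.Icarr[OF J] module_ideal_prod_act by simp
next
  case (add v w)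
  then show ?case
    using linear_mapsD[OF g] module_ideal_prod_carrier[OF J] module_ideal_prod_add by simp
qed

lemma act_finsum:
  assumes "finite F" and a: "a \<in> carrier A"
    and "\<And>i. i \<in> F \<Longrightarrow> x i \<in> carrier A" "\<And>i. i \<in> F \<Longrightarrow> e i \<in> carrier V"
  shows "a \<odot>\<^bsub>V\<^esub> (\<Oplus>\<^bsub>V\<^esub>i\<in>F. x i \<odot>\<^bsub>V\<^esub> e i) = (\<Oplus>\<^bsub>V\<^esub>i\<in>F. (x i \<otimes>\<^bsub>A\<^esub> a) \<odot>\<^bsub>V\<^esub> e i)"
  using assms(1,3,4)
proof (induction rule: finite_induct)
  case empty
  show ?case using act_zero[OF a] by simp
next
  case (insert i F)
  then have "(\<lambda>i. x i \<odot>\<^bsub>V\<^esub> e i) \<in> insert i F \<rightarrow> carrier V"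
    "(\<lambda>i. (x i \<otimes>\<^bsub>A\<^esub> a) \<odot>\<^bsub>V\<^esub> e i) \<in> insert i F \<rightarrow> carrier V"
    "(x i \<otimes>\<^bsub>A\<^esub> a) \<odot>\<^bsub>V\<^esub> e i = a \<odot>\<^bsub>V\<^esub> (x i \<odot>\<^bsub>V\<^esub> e i)"
    using a by (auto intro!: act_closed act_mult)
  then show ?case
    using insert act_add_vector[OF a] V.finsum_closed[of "\<lambda>i. x i \<odot>\<^bsub>V\<^esub> e i" F]
    by (simp add: Pi_iff)
qed

lemma combination_linear:
  fixes m :: nat
  assumes \<phi>: "\<And>i. i < m \<Longrightarrow> \<phi> i \<in> linear_maps A V (regular_module A)"
    and r: "\<And>i. i < m \<Longrightarrow> r i \<in> carrier V"
  shows "(\<lambda>v\<in>carrier V. \<Oplus>\<^bsub>V\<^esub>i\<in>{..<m}. \<phi> i v \<odot>\<^bsub>V\<^esub> r i) \<in> linear_maps A V V"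
proof -
  note \<phi>D = functionalD[OF \<phi>]
  have closed: "(\<Oplus>\<^bsub>V\<^esub>i\<in>{..<m}. \<phi> i v \<odot>\<^bsub>V\<^esub> r i) \<in> carrier V" if "v \<in> carrier V" for v
    using \<phi>D(1) r that act_closed by (intro V.finsum_closed) auto
  have "(\<Oplus>\<^bsub>V\<^esub>i\<in>{..<m}. \<phi> i (v \<oplus>\<^bsub>V\<^esub> w) \<odot>\<^bsub>V\<^esub> r i)
      = (\<Oplus>\<^bsub>V\<^esub>i\<in>{..<m}. \<phi> i v \<odot>\<^bsub>V\<^esub> r i) \<oplus>\<^bsub>V\<^esub> (\<Oplus>\<^bsub>V\<^esub>i\<in>{..<m}. \<phi> i w \<odot>\<^bsub>V\<^esub> r i)"
    if v: "v \<in> carrier V" and w: "w \<in> carrier V" for v w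
  proof -
    have "(\<Oplus>\<^bsub>V\<^esub>i\<in>{..<m}. \<phi> i (v \<oplus>\<^bsub>V\<^esub> w) \<odot>\<^bsub>V\<^esub> r i)
        = (\<Oplus>\<^bsub>V\<^esub>i\<in>{..<m}. \<phi> i v \<odot>\<^bsub>V\<^esub> r i \<oplus>\<^bsub>V\<^esub> \<phi> i w \<odot>\<^bsub>V\<^esub> r i)"
      by (rule V.finsum_cong') (use \<phi>D r v w act_closed act_add_scalar in auto)
    also have "\<dots> = (\<Oplus>\<^bsub>V\<^esub>i\<in>{..<m}. \<phi> i v \<odot>\<^bsub>V\<^esub> r i) \<oplus>\<^bsub>V\<^esub> (\<Oplus>\<^bsub>V\<^esub>i\<in>{..<m}. \<phi> i w \<odot>\<^bsub>V\<^esub> r i)"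
      by (rule V.finsum_addf) (use \<phi>D r v w act_closed in auto)
    finally show ?thesis .
  qed
  moreover have "(\<Oplus>\<^bsub>V\<^esub>i\<in>{..<m}. \<phi> i (a \<odot>\<^bsub>V\<^esub> v) \<odot>\<^bsub>V\<^esub> r i)
      = a \<odot>\<^bsub>V\<^esub> (\<Oplus>\<^bsub>V\<^esub>i\<in>{..<m}. \<phi> i v \<odot>\<^bsub>V\<^esub> r i)"
    if a: "a \<in> carrier A" and v: "v \<in> carrier V" for a v
  proof -
    have "(\<Oplus>\<^bsub>V\<^esub>i\<in>{..<m}. \<phi> i (a \<odot>\<^bsub>V\<^esub> v) \<odot>\<^bsub>V\<^esub> r i)
        = (\<Oplus>\<^bsub>V\<^esub>i\<in>{..<m}. (\<phi> i v \<otimes>\<^bsub>A\<^esub> a) \<odot>\<^bsub>V\<^esub> r i)"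
      by (rule V.finsum_cong') (use \<phi>D r a v act_closed in auto)
    also have "\<dots> = a \<odot>\<^bsub>V\<^esub> (\<Oplus>\<^bsub>V\<^esub>i\<in>{..<m}. \<phi> i v \<odot>\<^bsub>V\<^esub> r i)"
      by (rule act_finsum[symmetric]) (use \<phi>D r a v in auto)
    finally show ?thesis .
  qed
  ultimately show ?thesis
    using closed act_closed by (auto simp: linear_maps_def)
qed

text \<open>The coordinates with respect to a basis are linear because they are unique.\<close>
lemma free_coordinates:
  assumes "free_of_rank A V m"
  obtains e c where "\<And>i. i < m \<Longrightarrow> e i \<in> carrier V"
    and "\<And>i. i < m \<Longrightarrow> c i \<in> linear_maps A V (regular_module A)"
    and "\<And>v. v \<in> carrier V \<Longrightarrow> v = (\<Oplus>\<^bsub>V\<^esub>i\<in>{..<m}. c i v \<odot>\<^bsub>V\<^esub> e i)"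
proof -
  obtain e where e: "e \<in> {..<m} \<rightarrow> carrier V"
    and ex1: "\<And>v. v \<in> carrier V \<Longrightarrow>
       \<exists>!c. c \<in> ({..<m} \<rightarrow>\<^sub>E carrier A) \<and> v = (\<Oplus>\<^bsub>V\<^esub>i\<in>{..<m}. c i \<odot>\<^bsub>V\<^esub> e i)"
    by (rule bexE[OF assms[unfolded free_of_rank_def]]) (rule that, assumption, rule bspec)
  define x where "x v = (THE c. c \<in> ({..<m} \<rightarrow>\<^sub>E carrier A) \<and>
       v = (\<Oplus>\<^bsub>V\<^esub>i\<in>{..<m}. c i \<odot>\<^bsub>V\<^esub> e i))" for v
  have x: "x v \<in> {..<m} \<rightarrow>\<^sub>E carrier A" "(\<Oplus>\<^bsub>V\<^esub>i\<in>{..<m}. x v i \<odot>\<^bsub>V\<^esub> e i) = v"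
    if "v \<in> carrier V" for v
    using theI'[OF ex1[OF that]] unfolding x_def by auto
  have xc: "x v i \<in> carrier A" if "v \<in> carrier V" "i < m" for v i
    using x(1)[OF that(1)] that(2) by auto
  have ec: "e i \<in> carrier V" if "i < m" for i using e that by auto
  have uniq: "x v i = d i"
    if v: "v \<in> carrier V" and d: "\<And>i. i < m \<Longrightarrow> d i \<in> carrier A"
      and eq: "v = (\<Oplus>\<^bsub>V\<^esub>i\<in>{..<m}. d i \<odot>\<^bsub>V\<^esub> e i)" and i: "i < m" for v d i
  proof -
    have "(\<Oplus>\<^bsub>V\<^esub>i\<in>{..<m}. restrict d {..<m} i \<odot>\<^bsub>V\<^esub> e i) = (\<Oplus>\<^bsub>V\<^esub>i\<in>{..<m}. d i \<odot>\<^bsub>V\<^esub> e i)"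
      by (rule V.finsum_cong') (use d ec act_closed in auto)
    moreover have "restrict d {..<m} \<in> {..<m} \<rightarrow>\<^sub>E carrier A"
      using d by auto
    ultimately have "x v = restrict d {..<m}"
      using ex1[OF v] x[OF v] eq by auto
    then show ?thesis using i by simp
  qed
  have "(\<lambda>v\<in>carrier V. x v i) \<in> linear_maps A V (regular_module A)" if i: "i < m" for i
  proof (rule functionalI)
    fix v w assume v: "v \<in> carrier V" and w: "w \<in> carrier V"
    have "v \<oplus>\<^bsub>V\<^esub> w = (\<Oplus>\<^bsub>V\<^esub>i\<in>{..<m}. x v i \<odot>\<^bsub>V\<^esub> e i) \<oplus>\<^bsub>V\<^esub> (\<Oplus>\<^bsub>V\<^esub>i\<in>{..<m}. x w i \<odot>\<^bsub>V\<^esub> e i)"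
      using x v w by simp
    also have "\<dots> = (\<Oplus>\<^bsub>V\<^esub>i\<in>{..<m}. x v i \<odot>\<^bsub>V\<^esub> e i \<oplus>\<^bsub>V\<^esub> x w i \<odot>\<^bsub>V\<^esub> e i)"
      by (rule V.finsum_addf[symmetric]) (use xc ec v w act_closed in auto)
    also have "\<dots> = (\<Oplus>\<^bsub>V\<^esub>i\<in>{..<m}. (x v i \<oplus>\<^bsub>A\<^esub> x w i) \<odot>\<^bsub>V\<^esub> e i)"
      by (rule V.finsum_cong') (use xc ec v w act_closed act_add_scalar in auto)
    finally have sum: "v \<oplus>\<^bsub>V\<^esub> w = (\<Oplus>\<^bsub>V\<^esub>i\<in>{..<m}. (x v i \<oplus>\<^bsub>A\<^esub> x w i) \<odot>\<^bsub>V\<^esub> e i)" .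
    have "x (v \<oplus>\<^bsub>V\<^esub> w) i = x v i \<oplus>\<^bsub>A\<^esub> x w i"
      by (rule uniq[OF V.a_closed[OF v w] _ sum i]) (use xc v w in simp)
    then show "(\<lambda>v\<in>carrier V. x v i) (v \<oplus>\<^bsub>V\<^esub> w)
        = (\<lambda>v\<in>carrier V. x v i) v \<oplus>\<^bsub>A\<^esub> (\<lambda>v\<in>carrier V. x v i) w"
      using v w by simp
  next
    fix a v assume a: "a \<in> carrier A" and v: "v \<in> carrier V"
    have mult: "a \<odot>\<^bsub>V\<^esub> v = (\<Oplus>\<^bsub>V\<^esub>i\<in>{..<m}. (x v i \<otimes>\<^bsub>A\<^esub> a) \<odot>\<^bsub>V\<^esub> e i)"
      using act_finsum[of "{..<m}" a "x v" e] x(2)[OF v] xc[OF v] ec a by simp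
    have "x (a \<odot>\<^bsub>V\<^esub> v) i = x v i \<otimes>\<^bsub>A\<^esub> a"
      by (rule uniq[OF act_closed[OF a v] _ mult i]) (use xc v a in simp)
    then show "(\<lambda>v\<in>carrier V. x v i) (a \<odot>\<^bsub>V\<^esub> v) = (\<lambda>v\<in>carrier V. x v i) v \<otimes>\<^bsub>A\<^esub> a"
      using a v act_closed by simp
  qed (use xc i in auto)
  moreover have "v = (\<Oplus>\<^bsub>V\<^esub>i\<in>{..<m}. (\<lambda>v\<in>carrier V. x v i) v \<odot>\<^bsub>V\<^esub> e i)" if "v \<in> carrier V" for v
    using x(2)[OF that] that by simp
  ultimately show thesis using that[of e "\<lambda>i. \<lambda>v\<in>carrier V. x v i"] ec by blast
qed

text \<open>Nakayama's argument: a vector of \<open>V J\<close> is a sum of terms \<open>v a\<close> with \<open>a \<in> J\<close>, and rewriting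
  each \<open>v\<close> modulo \<open>g V\<close> improves the error from \<open>V J\<close> to \<open>V (I J)\<close>. Starting from \<open>J = A\<close>, the error
  reaches zero, since a power of \<open>I\<close> vanishes.\<close>
lemma surjective_of_surjective_mod:
  assumes I: "nilpotent_ideal I A" and g: "g \<in> linear_maps A V V"
    and surj: "\<And>v. v \<in> carrier V \<Longrightarrow>
      \<exists>u\<in>carrier V. \<exists>w\<in>module_ideal_prod V I. v = g u \<oplus>\<^bsub>V\<^esub> w"
  shows "g ` carrier V = carrier V"
proof -
  note gD = linear_mapsD[OF g]
  have II: "ideal I A" using I by (simp add: nilpotent_ideal_def)
  define P where "P n = (ideal_prod A I ^^ n) (carrier A)" for n
  have P: "ideal (P n) A" for n
    by (induction n) (simp_all add: P_def A.oneideal A.ideal_prod_is_ideal[OF II])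
  \<comment> \<open>The power \<open>P (Suc n)\<close> is the product of \<open>I\<close> and \<open>P n\<close>, in this order. It matches the right
    action: \<open>(v b) a = v (b a)\<close> with \<open>b \<in> I\<close> and \<open>a \<in> P n\<close>.\<close>
  have act_prod: "a \<odot>\<^bsub>V\<^esub> w \<in> module_ideal_prod V (ideal_prod A I K)"
    if K: "ideal K A" and a: "a \<in> K" and w: "w \<in> module_ideal_prod V I" for a w K
    using II w
  proof (induction rule: module_ideal_prod_induct)
    case zero
    show ?case using act_zero ideal.Icarr[OF K a] module_ideal_prod_zero by simp
  next
    case (act b v)
    then have "a \<odot>\<^bsub>V\<^esub> (b \<odot>\<^bsub>V\<^esub> v) = (b \<otimes>\<^bsub>A\<^esub> a) \<odot>\<^bsub>V\<^esub> v"
      using act_mult ideal.Icarr[OF K a] ideal.Icarr[OF II] by simp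
    then show ?case using module_ideal_prod_act[OF ideal_prod.prod[OF act(1) a] act(2)] by simp
  next
    case (add v w)
    then show ?case
      using act_add_vector ideal.Icarr[OF K a] module_ideal_prod_carrier[OF II] module_ideal_prod_add
      by simp
  qed
  have improve: "\<exists>u\<in>carrier V. \<exists>w'\<in>module_ideal_prod V (P (Suc n)). w = g u \<oplus>\<^bsub>V\<^esub> w'"
    if "w \<in> module_ideal_prod V (P n)" for w n
    using P that
  proof (induction rule: module_ideal_prod_induct)
    case zero
    show ?case
      using linear_map_zero[OF g] module_ideal_prod_zero by (intro bexI[of _ "\<zero>\<^bsub>V\<^esub>"]) auto
  next
    case (act a v)
    then obtain u w where uw: "u \<in> carrier V" "w \<in> module_ideal_prod V I" "v = g u \<oplus>\<^bsub>V\<^esub> w"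
      using surj by blast
    have "a \<odot>\<^bsub>V\<^esub> v = g (a \<odot>\<^bsub>V\<^esub> u) \<oplus>\<^bsub>V\<^esub> a \<odot>\<^bsub>V\<^esub> w"
      using uw gD(1,3) act_add_vector ideal.Icarr[OF P act(1)] module_ideal_prod_carrier[OF II]
      by simp
    moreover have "a \<odot>\<^bsub>V\<^esub> w \<in> module_ideal_prod V (P (Suc n))"
      using act_prod[OF P act(1) uw(2)] by (simp add: P_def)
    moreover have "a \<odot>\<^bsub>V\<^esub> u \<in> carrier V" using act_closed ideal.Icarr[OF P act(1)] uw(1) .
    ultimately show ?case by blast
  next
    case (add v w)
    then obtain x x' y y' where "x \<in> carrier V" "y \<in> carrier V"
      "x' \<in> module_ideal_prod V (P (Suc n))" "y' \<in> module_ideal_prod V (P (Suc n))"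
      "v = g x \<oplus>\<^bsub>V\<^esub> x'" "w = g y \<oplus>\<^bsub>V\<^esub> y'" by blast
    moreover from this have "v \<oplus>\<^bsub>V\<^esub> w = g (x \<oplus>\<^bsub>V\<^esub> y) \<oplus>\<^bsub>V\<^esub> (x' \<oplus>\<^bsub>V\<^esub> y')"
      using gD(1,2) module_ideal_prod_carrier[OF P] by (simp add: V.add.m_ac)
    ultimately show ?case using V.a_closed module_ideal_prod_add by blast
  qed
  have approx: "\<exists>u\<in>carrier V. \<exists>w\<in>module_ideal_prod V (P n). v = g u \<oplus>\<^bsub>V\<^esub> w"
    if v: "v \<in> carrier V" for v n
  proof (induction n)
    case 0
    have "v \<in> module_ideal_prod V (P 0)"
      using module_ideal_prod_act[of \<one> "P 0" v] v act_one by (simp add: P_def)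
    then show ?case
      using linear_map_zero[OF g] v by (intro bexI[of _ "\<zero>\<^bsub>V\<^esub>"] bexI[of _ v]) auto
  next
    case (Suc n)
    then obtain u w where u: "u \<in> carrier V" "w \<in> module_ideal_prod V (P n)" "v = g u \<oplus>\<^bsub>V\<^esub> w"
      by blast
    obtain u' w' where u': "u' \<in> carrier V" "w' \<in> module_ideal_prod V (P (Suc n))" "w = g u' \<oplus>\<^bsub>V\<^esub> w'"
      using improve[OF u(2)] by blast
    have "v = g (u \<oplus>\<^bsub>V\<^esub> u') \<oplus>\<^bsub>V\<^esub> w'"
      using u u' gD(1,2) module_ideal_prod_carrier[OF P] by (simp add: V.a_assoc)
    then show ?case using u(1) u'(1,2) V.a_closed by blast
  qed
  obtain n where n: "P n = {\<zero>\<^bsub>A\<^esub>}"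
    using I by (auto simp: nilpotent_ideal_def P_def)
  have zero: "w = \<zero>\<^bsub>V\<^esub>" if "w \<in> module_ideal_prod V (P n)" for w
    using P that
  proof (induction rule: module_ideal_prod_induct)
    case (act a v)
    then show ?case using zero_act n by simp
  qed simp_all
  have "v \<in> g ` carrier V" if "v \<in> carrier V" for v
    using approx[OF that, of n] zero gD(1) by force
  then show ?thesis using gD(1) by blast
qed

end

section \<open>Hermitian forms and Newton's method\<close>

context involution_ring
begin

lemma star_zero: "star \<zero> = \<zero>"
  using star_add[of \<zero> \<zero>] star_closed[of \<zero>] by (simp add: add.l_cancel_one)

lemma star_minus: "a \<in> carrier A \<Longrightarrow> star (\<ominus> a) = \<ominus> star a"
  using star_add[of "\<ominus> a" a] star_closed star_zero
  by (intro minus_equality[symmetric]) (auto simp: l_neg)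

lemma star_ideal_prod:
  assumes J: "ideal J A" and star: "star ` J \<subseteq> J"
  shows "star ` ideal_prod A J J \<subseteq> ideal_prod A J J"
proof (rule image_subsetI)
  fix x assume "x \<in> ideal_prod A J J"
  then show "star x \<in> ideal_prod A J J"
  proof (induction rule: ideal_prod.induct)
    case (prod i j)
    then show ?case
      using star star_mult ideal.Icarr[OF J] by (auto intro: ideal_prod.prod)
  next
    case (sum s1 s2)
    then show ?case
      using star_add ideal_prod_in_carrier[OF J J] by (auto simp: subset_iff intro: ideal_prod.sum)
  qed
qed

end

text \<open>The form values for \<open>g (1 + y)\<close> expand to the left-hand side, where \<open>p\<close> is the original value and
  \<open>d\<close> the error of \<open>g\<close>. The two cross terms each contribute \<open>- d / 2\<close>, which removes \<open>d\<close>; only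
  terms of higher order remain.\<close>
lemma (in ring) half_corrections_cancel:
  assumes carr: "p \<in> carrier R" "d \<in> carrier R" "c \<in> carrier R"
    "r \<in> carrier R" "s \<in> carrier R" "t \<in> carrier R"
    and half: "c \<oplus> c = \<one>"
  shows "((p \<oplus> d) \<oplus> (\<ominus> (c \<otimes> d) \<oplus> r)) \<oplus> ((\<ominus> (c \<otimes> d) \<oplus> s) \<oplus> t) \<ominus> p = r \<oplus> s \<oplus> t"
proof -
  define e where "e = c \<otimes> d"
  have "e \<oplus> e = (c \<oplus> c) \<otimes> d" unfolding e_def using carr by (simp add: l_distr)
  then have d: "d = e \<oplus> e" using half carr by simp
  have "e \<in> carrier R" using carr by (simp add: e_def)
  with carr show ?thesis unfolding e_def[symmetric] unfolding d by algebra
qed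

lemma (in ring) minus_cancel_add:
  "x \<in> carrier R \<Longrightarrow> y \<in> carrier R \<Longrightarrow> y \<oplus> (x \<ominus> y) = x"
  by algebra

lemma (in ring) minus_distribs:
  assumes "a \<in> carrier R" "b \<in> carrier R" "c \<in> carrier R" "d \<in> carrier R"
  shows "(a \<oplus> b) \<ominus> (c \<oplus> d) = (a \<ominus> c) \<oplus> (b \<ominus> d)"
    and "a \<otimes> d \<ominus> b \<otimes> d = (a \<ominus> b) \<otimes> d"
    and "\<ominus> (c \<otimes> (a \<oplus> b)) = \<ominus> (c \<otimes> a) \<oplus> \<ominus> (c \<otimes> b)"
    and "\<ominus> (c \<otimes> (a \<otimes> b)) = \<ominus> (c \<otimes> a) \<otimes> b"
  using assms by algebra+

context hermitian_space
begin

lemma h_act_left: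
  assumes "a \<in> carrier A" "u \<in> carrier V" "v \<in> carrier V"
  shows "h (a \<odot>\<^bsub>V\<^esub> u) v = star a \<otimes>\<^bsub>A\<^esub> h u v"
proof -
  have "h (a \<odot>\<^bsub>V\<^esub> u) v = star (h v u \<otimes>\<^bsub>A\<^esub> a)"
    using h_hermitian[of v "a \<odot>\<^bsub>V\<^esub> u"] h_act_right[of v u a] assms act_closed by simp
  also have "\<dots> = star a \<otimes>\<^bsub>A\<^esub> h u v"
    using star_mult[of "h v u" a] h_hermitian[of v u] h_closed assms by simp
  finally show ?thesis .
qed

lemma h_functional:
  "u \<in> carrier V \<Longrightarrow> (\<lambda>v\<in>carrier V. h u v) \<in> linear_maps A V (regular_module A)"
  by (rule functionalI) (use h_closed h_add_right h_act_right act_closed in auto)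

text \<open>Surjectivity of the map from \<open>V\<close> to its dual: this is how vectors with prescribed products are
  constructed.\<close>
lemma functional_represented:
  assumes "\<phi> \<in> linear_maps A V (regular_module A)"
  obtains u where "u \<in> carrier V" "\<And>v. v \<in> carrier V \<Longrightarrow> h u v = \<phi> v"
proof -
  have "\<phi> \<in> (\<lambda>u\<in>carrier V. \<lambda>v\<in>carrier V. h u v) ` carrier V"
    using assms bij_betw_imp_surj_on[OF h_nondegenerate_bij] by (simp add: dual_module_def)
  then obtain u where "u \<in> carrier V" "\<phi> = (\<lambda>v\<in>carrier V. h u v)"
    by auto
  then show thesis using that by simp
qed

lemma h_left_cancel:
  assumes "u \<in> carrier V" "w \<in> carrier V" "\<And>v. v \<in> carrier V \<Longrightarrow> h u v = h w v"
  shows "u = w"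
proof (rule inj_onD[OF bij_betw_imp_inj_on[OF h_nondegenerate_bij] _ assms(1,2)])
  show "(\<lambda>u\<in>carrier V. \<lambda>v\<in>carrier V. h u v) u = (\<lambda>u\<in>carrier V. \<lambda>v\<in>carrier V. h u v) w"
    using assms by (auto simp: fun_eq_iff)
qed

text \<open>Each coordinate functional is \<open>h f\<^sub>i\<close> for some vector \<open>f\<^sub>i\<close>, so the coordinates of
  \<open>w\<close> are values of the form at \<open>w\<close>.\<close>
lemma in_module_ideal_prodI:
  assumes J: "ideal J A" and star: "star ` J \<subseteq> J"
    and w: "w \<in> carrier V" and vals: "\<And>v. v \<in> carrier V \<Longrightarrow> h w v \<in> J"
  shows "w \<in> module_ideal_prod V J"
proof -
  obtain e c where e: "\<And>i. i < m \<Longrightarrow> e i \<in> carrier V"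
    and c: "\<And>i. i < m \<Longrightarrow> c i \<in> linear_maps A V (regular_module A)"
    and expand: "\<And>v. v \<in> carrier V \<Longrightarrow> v = (\<Oplus>\<^bsub>V\<^esub>i\<in>{..<m}. c i v \<odot>\<^bsub>V\<^esub> e i)"
    by (rule free_coordinates[OF free]) blast
  have "c i w \<in> J" if i: "i < m" for i
  proof -
    obtain f where f: "f \<in> carrier V" "\<And>v. v \<in> carrier V \<Longrightarrow> h f v = c i v"
      using functional_represented[OF c[OF i]] by blast
    then have "c i w = star (h w f)"
      using h_hermitian[OF w f(1)] w by simp
    then show ?thesis using star vals[OF f(1)] by auto
  qed
  then have "(\<Oplus>\<^bsub>V\<^esub>i\<in>{..<m}. c i w \<odot>\<^bsub>V\<^esub> e i) \<in> module_ideal_prod V J"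
    by (intro finsum_in_module_ideal_prod) (use e ideal.Icarr[OF J] in auto)
  then show ?thesis using expand[OF w] by simp
qed

lemma h_module_ideal_prod_right:
  assumes J: "ideal J A" and u: "u \<in> carrier V" and w: "w \<in> module_ideal_prod V J"
  shows "h u w \<in> J"
proof -
  have "(\<lambda>v\<in>carrier V. h u v) w \<in> ideal_prod A (carrier A) J"
    by (rule functional_ideal_prod[OF h_functional[OF u] _ oneideal J w]) (use h_closed u in auto)
  then show ?thesis
    using ideal_prod_inter[OF oneideal J] module_ideal_prod_carrier[OF J w] by auto
qed

lemma h_module_ideal_prod_left:
  assumes J: "ideal J A" "star ` J \<subseteq> J" and u: "u \<in> carrier V" and w: "w \<in> module_ideal_prod V J"
  shows "h w u \<in> J"
  using h_module_ideal_prod_right[OF J(1) u w] J(2) h_hermitian[OF u module_ideal_prod_carrier[OF J(1) w]]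
  by auto

lemma h_module_ideal_prod_both:
  assumes J: "ideal J A" "star ` J \<subseteq> J"
    and v: "v \<in> module_ideal_prod V J" and w: "w \<in> module_ideal_prod V J"
  shows "h v w \<in> ideal_prod A J J"
proof -
  have vV: "v \<in> carrier V" by (rule module_ideal_prod_carrier[OF J(1) v])
  have "(\<lambda>x\<in>carrier V. h v x) w \<in> ideal_prod A J J"
    by (rule functional_ideal_prod[OF h_functional[OF vV] _ J(1) J(1) w])
      (use h_module_ideal_prod_left[OF J _ v] in auto)
  then show ?thesis using module_ideal_prod_carrier[OF J(1) w] by simp
qed

definition defect :: "('b \<Rightarrow> 'b) \<Rightarrow> 'b \<Rightarrow> 'b \<Rightarrow> 'a" where
  "defect g u v = h (g u) (g v) \<ominus>\<^bsub>A\<^esub> h u v"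

lemma defect_closed:
  assumes "g \<in> linear_maps A V V" "u \<in> carrier V" "v \<in> carrier V"
  shows "defect g u v \<in> carrier A"
  unfolding defect_def using linear_mapsD(1)[OF assms(1)] assms(2,3) h_closed by simp

lemma defect_star:
  assumes "g \<in> linear_maps A V V" "u \<in> carrier V" "v \<in> carrier V"
  shows "star (defect g u v) = defect g v u"
  unfolding defect_def a_minus_def
  using linear_mapsD(1)[OF assms(1)] assms(2,3) h_closed h_hermitian[of u v]
    h_hermitian[of "g u" "g v"] by (simp add: star_add star_minus)

lemma h_map_eq:
  assumes "g \<in> linear_maps A V V" "u \<in> carrier V" "v \<in> carrier V"
  shows "h (g u) (g v) = h u v \<oplus>\<^bsub>A\<^esub> defect g u v"
  unfolding defect_def using linear_mapsD(1)[OF assms(1)] assms(2,3) h_closed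
  by (simp add: minus_cancel_add)

lemma defect_functional:
  assumes g: "g \<in> linear_maps A V V" and u: "u \<in> carrier V"
  shows "(\<lambda>v\<in>carrier V. defect g u v) \<in> linear_maps A V (regular_module A)"
proof (rule functionalI)
  note gD = linear_mapsD[OF g]
  show "(\<lambda>v\<in>carrier V. defect g u v) (v \<oplus>\<^bsub>V\<^esub> w)
      = (\<lambda>v\<in>carrier V. defect g u v) v \<oplus>\<^bsub>A\<^esub> (\<lambda>v\<in>carrier V. defect g u v) w"
    if "v \<in> carrier V" "w \<in> carrier V" for v w
    using that u gD(1,2) h_add_right h_closed by (simp add: defect_def minus_distribs(1))
  show "(\<lambda>v\<in>carrier V. defect g u v) (a \<odot>\<^bsub>V\<^esub> v)
      = (\<lambda>v\<in>carrier V. defect g u v) v \<otimes>\<^bsub>A\<^esub> a"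
    if "a \<in> carrier A" "v \<in> carrier V" for a v
    using that u gD(1,3) h_act_right h_closed act_closed by (simp add: defect_def minus_distribs(2))
qed (use defect_closed[OF g u] in auto)

lemma defect_add_right:
  assumes "g \<in> linear_maps A V V" "u \<in> carrier V" "v \<in> carrier V" "w \<in> carrier V"
  shows "defect g u (v \<oplus>\<^bsub>V\<^esub> w) = defect g u v \<oplus>\<^bsub>A\<^esub> defect g u w"
  using functionalD(2)[OF defect_functional[OF assms(1,2)] assms(3,4)] assms(3,4) by simp

lemma defect_act_right:
  assumes "g \<in> linear_maps A V V" "u \<in> carrier V" "v \<in> carrier V" "a \<in> carrier A"
  shows "defect g u (a \<odot>\<^bsub>V\<^esub> v) = defect g u v \<otimes>\<^bsub>A\<^esub> a"
  using functionalD(3)[OF defect_functional[OF assms(1,2)] assms(4,3)] assms(3,4) act_closed by simp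

lemma defect_ideal_prod_right:
  assumes g: "g \<in> linear_maps A V V" and J: "ideal J A"
    and D: "\<And>u v. u \<in> carrier V \<Longrightarrow> v \<in> carrier V \<Longrightarrow> defect g u v \<in> J"
    and u: "u \<in> carrier V" and w: "w \<in> module_ideal_prod V J"
  shows "defect g u w \<in> ideal_prod A J J"
proof -
  have "(\<lambda>x\<in>carrier V. defect g u x) w \<in> ideal_prod A J J"
    by (rule functional_ideal_prod[OF defect_functional[OF g u] _ J J w]) (use D u in auto)
  then show ?thesis using module_ideal_prod_carrier[OF J w] by simp
qed

text \<open>Newton's method for the equation \<open>h (g u) (g v) = h u v\<close>. Write \<open>D\<close> for the defect of \<open>g\<close>. As \<open>h\<close> is
  nondegenerate, \<open>h (y u) v = - D(u, v) / 2\<close> defines a linear map \<open>y\<close>, which takes values in \<open>V J\<close>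
  since \<open>D\<close> takes values in \<open>J\<close>. Replace \<open>g\<close> by \<open>g (1 + y)\<close>. The form satisfies
  \<open>h (g (y u)) (g v) = h (y u) v + D(y u, v)\<close> and \<open>h (g u) (g (y v)) = h u (y v) + D(u, y v)\<close>,
  so the two cross terms cancel \<open>D\<close> up to \<open>D(y u, v) + D(u, y v)\<close>. These two terms
  are in \<open>J\<^sup>2\<close> because \<open>D\<close> and \<open>y\<close> each contribute a factor from \<open>J\<close>; so is
  \<open>h (g (y u)) (g (y v))\<close>, in which \<open>y\<close> occurs twice. The map \<open>y\<close> is specified
  by means of \<open>h\<close> rather than \<open>g\<close>, so that no inverse of \<open>g\<close> enters.\<close>
lemma correction_step:
  assumes g: "g \<in> linear_maps A V V" and J: "ideal J A" "star ` J \<subseteq> J"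
    and D: "\<And>u v. u \<in> carrier V \<Longrightarrow> v \<in> carrier V \<Longrightarrow> defect g u v \<in> J"
    and c: "c \<in> carrier A" "star c = c" "c \<oplus>\<^bsub>A\<^esub> c = \<one>\<^bsub>A\<^esub>"
      "\<And>a. a \<in> carrier A \<Longrightarrow> c \<otimes>\<^bsub>A\<^esub> a = a \<otimes>\<^bsub>A\<^esub> c"
  obtains g' where "g' \<in> linear_maps A V V"
    and "\<And>u v. u \<in> carrier V \<Longrightarrow> v \<in> carrier V \<Longrightarrow> defect g' u v \<in> ideal_prod A J J"
    and "\<And>u. u \<in> carrier V \<Longrightarrow> \<exists>w\<in>module_ideal_prod V J. g' u = g u \<oplus>\<^bsub>V\<^esub> w"
proof -
  note gD = linear_mapsD[OF g]
  have ex: "\<exists>w\<in>carrier V. \<forall>v\<in>carrier V. h w v = \<ominus>\<^bsub>A\<^esub> (c \<otimes>\<^bsub>A\<^esub> defect g u v)"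
    if u: "u \<in> carrier V" for u
  proof -
    have "(\<lambda>v\<in>carrier V. \<ominus>\<^bsub>A\<^esub> (c \<otimes>\<^bsub>A\<^esub> defect g u v)) \<in> linear_maps A V (regular_module A)"
      by (rule functionalI)
        (use u c(1) defect_closed[OF g] defect_add_right[OF g] defect_act_right[OF g] act_closed
          in \<open>auto simp: minus_distribs(3,4)\<close>)
    then show ?thesis by (rule functional_represented) auto
  qed
  define y where "y u = (SOME w. w \<in> carrier V \<and>
    (\<forall>v\<in>carrier V. h w v = \<ominus>\<^bsub>A\<^esub> (c \<otimes>\<^bsub>A\<^esub> defect g u v)))" for u
  have y: "y u \<in> carrier V" "\<And>v. v \<in> carrier V \<Longrightarrow> h (y u) v = \<ominus>\<^bsub>A\<^esub> (c \<otimes>\<^bsub>A\<^esub> defect g u v)"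
    if "u \<in> carrier V" for u
    using someI_ex[OF ex[OF that, unfolded Bex_def]] unfolding y_def by auto
  have left: "defect g u v = star (defect g v u)" if "u \<in> carrier V" "v \<in> carrier V" for u v
    using defect_star[OF g that(2,1)] by simp
  \<comment> \<open>Linearity of \<open>y\<close> is inherited from the defect, because \<open>h\<close> determines \<open>y u\<close>.\<close>
  have y_add: "y (u \<oplus>\<^bsub>V\<^esub> u') = y u \<oplus>\<^bsub>V\<^esub> y u'" if u: "u \<in> carrier V" "u' \<in> carrier V" for u u'
  proof (rule h_left_cancel)
    fix v assume v: "v \<in> carrier V"
    have "defect g (u \<oplus>\<^bsub>V\<^esub> u') v = defect g u v \<oplus>\<^bsub>A\<^esub> defect g u' v"
      using u v left[OF V.a_closed[OF u] v] defect_add_right[OF g v u] defect_closed[OF g]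
      by (simp add: star_add defect_star[OF g])
    then show "h (y (u \<oplus>\<^bsub>V\<^esub> u')) v = h (y u \<oplus>\<^bsub>V\<^esub> y u') v"
      using u v y c(1) h_add_left defect_closed[OF g] by (simp add: minus_distribs(3))
  qed (use u y in auto)
  have y_act: "y (a \<odot>\<^bsub>V\<^esub> u) = a \<odot>\<^bsub>V\<^esub> y u" if a: "a \<in> carrier A" and u: "u \<in> carrier V" for a u
  proof (rule h_left_cancel)
    fix v assume v: "v \<in> carrier V"
    have "defect g (a \<odot>\<^bsub>V\<^esub> u) v = star a \<otimes>\<^bsub>A\<^esub> defect g u v"
      using a u v left[OF act_closed[OF a u] v] defect_act_right[OF g v u a] defect_closed[OF g]
      by (simp add: star_mult defect_star[OF g])
    then have "h (y (a \<odot>\<^bsub>V\<^esub> u)) v = \<ominus>\<^bsub>A\<^esub> (c \<otimes>\<^bsub>A\<^esub> (star a \<otimes>\<^bsub>A\<^esub> defect g u v))"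
      using a u v y act_closed by simp
    \<comment> \<open>The scalar \<open>a\<close> comes out on the left as \<open>star a\<close>, past \<open>c\<close>, which is
      central.\<close>
    also have "\<dots> = \<ominus>\<^bsub>A\<^esub> (star a \<otimes>\<^bsub>A\<^esub> (c \<otimes>\<^bsub>A\<^esub> defect g u v))"
      using c(1) c(4)[of "star a"] star_closed[OF a] defect_closed[OF g u v]
      by (simp add: m_assoc[symmetric])
    also have "\<dots> = star a \<otimes>\<^bsub>A\<^esub> h (y u) v"
      using c(1) star_closed[OF a] defect_closed[OF g u v] y[OF u] v by (simp add: r_minus)
    finally show "h (y (a \<odot>\<^bsub>V\<^esub> u)) v = h (a \<odot>\<^bsub>V\<^esub> y u) v"
      using h_act_left a u v y by simp
  qed (use a u y act_closed in auto)
  have yJ: "y u \<in> module_ideal_prod V J" if u: "u \<in> carrier V" for u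
  proof (rule in_module_ideal_prodI[OF J y(1)[OF u]])
    show "h (y u) v \<in> J" if v: "v \<in> carrier V" for v
      using y(2)[OF u v] ideal.I_l_closed[OF J(1) D[OF u v] c(1)]
      by (simp add: additive_subgroup.a_inv_closed[OF ideal.axioms(1)[OF J(1)]])
  qed
  define g' where "g' = (\<lambda>u\<in>carrier V. g u \<oplus>\<^bsub>V\<^esub> g (y u))"
  have g'_lin: "g' \<in> linear_maps A V V"
    unfolding linear_maps_def g'_def
    using gD y(1) y_add y_act act_closed act_add_vector by (auto simp: V.add.m_ac)
  let ?K = "ideal_prod A J J"
  have K: "ideal ?K A" "star ` ?K \<subseteq> ?K"
    using ideal_prod_is_ideal[OF J(1) J(1)] star_ideal_prod[OF J] by auto
  have "defect g' u v \<in> ?K" if u: "u \<in> carrier V" and v: "v \<in> carrier V" for u v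
  proof -
    let ?d = "defect g u v" and ?r = "defect g (y u) v" and ?s = "defect g u (y v)"
      and ?t = "h (g (y u)) (g (y v))"
    note dc = defect_closed[OF g]
    have s: "?s \<in> ?K" by (rule defect_ideal_prod_right[OF g J(1) D u yJ[OF v]])
    have "defect g v (y u) \<in> ?K" by (rule defect_ideal_prod_right[OF g J(1) D v yJ[OF u]])
    then have r: "?r \<in> ?K" using left[OF y(1)[OF u] v] K(2) by auto
    have t: "?t \<in> ?K"
      using h_module_ideal_prod_both[OF J] linear_map_module_ideal_prod[OF g J(1)] yJ u v by blast
    have "h (g (y u)) (g v) = \<ominus>\<^bsub>A\<^esub> (c \<otimes>\<^bsub>A\<^esub> ?d) \<oplus>\<^bsub>A\<^esub> ?r"
      using h_map_eq[OF g y(1)[OF u] v] y(2)[OF u v] by simp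
    moreover have "h u (y v) = \<ominus>\<^bsub>A\<^esub> (c \<otimes>\<^bsub>A\<^esub> ?d)"
    proof -
      have "h u (y v) = star (\<ominus>\<^bsub>A\<^esub> (c \<otimes>\<^bsub>A\<^esub> defect g v u))"
        using h_hermitian[OF y(1)[OF v] u] y(2)[OF v u] by simp
      also have "\<dots> = \<ominus>\<^bsub>A\<^esub> (?d \<otimes>\<^bsub>A\<^esub> c)"
        using c(1,2) dc u v left[OF u v] by (simp add: star_minus star_mult)
      finally show ?thesis using c(4) dc[OF u v] by simp
    qed
    then have "h (g u) (g (y v)) = \<ominus>\<^bsub>A\<^esub> (c \<otimes>\<^bsub>A\<^esub> ?d) \<oplus>\<^bsub>A\<^esub> ?s"
      using h_map_eq[OF g u y(1)[OF v]] by simp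
    moreover have "h (g u) (g v) = h u v \<oplus>\<^bsub>A\<^esub> ?d" by (rule h_map_eq[OF g u v])
    ultimately have "h (g' u) (g' v) =
        ((h u v \<oplus>\<^bsub>A\<^esub> ?d) \<oplus>\<^bsub>A\<^esub> (\<ominus>\<^bsub>A\<^esub> (c \<otimes>\<^bsub>A\<^esub> ?d) \<oplus>\<^bsub>A\<^esub> ?r))
          \<oplus>\<^bsub>A\<^esub> ((\<ominus>\<^bsub>A\<^esub> (c \<otimes>\<^bsub>A\<^esub> ?d) \<oplus>\<^bsub>A\<^esub> ?s) \<oplus>\<^bsub>A\<^esub> ?t)"
      using u v gD(1) y(1) by (simp add: g'_def h_add_left h_add_right)
    then have "defect g' u v = ?r \<oplus>\<^bsub>A\<^esub> ?s \<oplus>\<^bsub>A\<^esub> ?t"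
      unfolding defect_def[of g'] using half_corrections_cancel[OF h_closed[OF u v] dc[OF u v] c(1)
        dc[OF y(1)[OF u] v] dc[OF u y(1)[OF v]] h_closed[OF gD(1)[OF y(1)[OF u]] gD(1)[OF y(1)[OF v]]] c(3)] by simp
    then show ?thesis
      using r s t additive_subgroup.a_closed[OF ideal.axioms(1)[OF K(1)]] by simp
  qed
  moreover have "\<exists>w\<in>module_ideal_prod V J. g' u = g u \<oplus>\<^bsub>V\<^esub> w" if "u \<in> carrier V" for u
    using linear_map_module_ideal_prod[OF g J(1) yJ[OF that]] that by (auto simp: g'_def)
  ultimately show thesis using that g'_lin by blast
qed

end

section \<open>Isometries near approximate isometries\<close>

lemma ideal_prod_subset:
  assumes "J \<subseteq> J'" "K \<subseteq> K'"
  shows "ideal_prod R J K \<subseteq> ideal_prod R J' K'"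
proof
  fix x assume "x \<in> ideal_prod R J K"
  then show "x \<in> ideal_prod R J' K'"
    by (induction rule: ideal_prod.induct) (use assms in \<open>auto intro: ideal_prod.intros\<close>)
qed

context hermitian_space
begin

text \<open>Each correction squares the ideal that contains the defect. The successive squares \<open>K n\<close>
  of \<open>I\<close> are contained in the powers \<open>P (Suc n)\<close>, so they reach zero. Squares are used for the
  iteration because they are visibly invariant under the involution.\<close>
lemma isometry_near:
  assumes I: "nilpotent_ideal I A" "star ` I \<subseteq> I"
    and c: "c \<in> carrier A" "star c = c" "c \<oplus>\<^bsub>A\<^esub> c = \<one>\<^bsub>A\<^esub>"
      "\<And>a. a \<in> carrier A \<Longrightarrow> c \<otimes>\<^bsub>A\<^esub> a = a \<otimes>\<^bsub>A\<^esub> c"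
    and g: "g \<in> linear_maps A V V"
    and D: "\<And>u v. u \<in> carrier V \<Longrightarrow> v \<in> carrier V \<Longrightarrow> defect g u v \<in> I"
  obtains f where "f \<in> linear_maps A V V"
    and "\<And>u v. u \<in> carrier V \<Longrightarrow> v \<in> carrier V \<Longrightarrow> h (f u) (f v) = h u v"
    and "\<And>u. u \<in> carrier V \<Longrightarrow> \<exists>w\<in>module_ideal_prod V I. f u = g u \<oplus>\<^bsub>V\<^esub> w"
proof -
  have II: "ideal I A" using I by (simp add: nilpotent_ideal_def)
  define P where "P n = (ideal_prod A I ^^ n) (carrier A)" for n
  define K where "K n = ((\<lambda>J. ideal_prod A J J) ^^ n) I" for n
  have K_Suc: "K (Suc n) = ideal_prod A (K n) (K n)" and K_0: "K 0 = I" for n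
    by (simp_all add: K_def)
  have P: "ideal (P n) A" for n
    by (induction n) (simp_all add: P_def oneideal ideal_prod_is_ideal[OF II])
  have K: "ideal (K n) A \<and> star ` K n \<subseteq> K n \<and> K n \<subseteq> I" for n
  proof (induction n)
    case (Suc n)
    then show ?case
      using ideal_prod_is_ideal[of "K n" "K n"] star_ideal_prod[of "K n"]
        ideal_prod_inter[of "K n" "K n"] by (auto simp: K_Suc)
  qed (use II I K_0 in auto)
  have KP: "K n \<subseteq> P (Suc n)" for n
  proof (induction n)
    case 0
    have "x \<in> ideal_prod A I (carrier A)" if "x \<in> I" for x
      using ideal_prod.prod[OF that one_closed, of A] ideal.Icarr[OF II that] by simp
    then show ?case by (auto simp: K_0 P_def)
  next
    case (Suc n)
    then show ?case
      using ideal_prod_subset[of "K n" I "K n" "P (Suc n)" A] K[of n] by (simp add: K_Suc P_def)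
  qed
  obtain n where "P n = {\<zero>\<^bsub>A\<^esub>}"
    using I by (auto simp: nilpotent_ideal_def P_def)
  moreover have "P (Suc n) \<subseteq> P n"
    using ideal_prod_inter[OF II P] by (simp add: P_def)
  ultimately have Kn: "K n \<subseteq> {\<zero>\<^bsub>A\<^esub>}" using KP by blast
  have all: "\<exists>f\<in>linear_maps A V V. (\<forall>u\<in>carrier V. \<forall>v\<in>carrier V. defect f u v \<in> K n) \<and>
    (\<forall>u\<in>carrier V. \<exists>w\<in>module_ideal_prod V I. f u = g u \<oplus>\<^bsub>V\<^esub> w)" for n
  proof (induction n)
    case 0
    have "\<exists>w\<in>module_ideal_prod V I. g u = g u \<oplus>\<^bsub>V\<^esub> w" if "u \<in> carrier V" for u
      using module_ideal_prod_zero linear_mapsD(1)[OF g that]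
      by (intro bexI[of _ "\<zero>\<^bsub>V\<^esub>"]) auto
    then show ?case using g D K_0 by auto
  next
    case (Suc n)
    then obtain f where f: "f \<in> linear_maps A V V"
      and Df: "\<And>u v. u \<in> carrier V \<Longrightarrow> v \<in> carrier V \<Longrightarrow> defect f u v \<in> K n"
      and fg: "\<And>u. u \<in> carrier V \<Longrightarrow> \<exists>w\<in>module_ideal_prod V I. f u = g u \<oplus>\<^bsub>V\<^esub> w"
      by auto
    obtain f' where f': "f' \<in> linear_maps A V V"
      and Df': "\<And>u v. u \<in> carrier V \<Longrightarrow> v \<in> carrier V \<Longrightarrow> defect f' u v \<in> K (Suc n)"
      and ff': "\<And>u. u \<in> carrier V \<Longrightarrow> \<exists>w\<in>module_ideal_prod V (K n). f' u = f u \<oplus>\<^bsub>V\<^esub> w"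
      using correction_step[OF f conjunct1[OF K] conjunct1[OF conjunct2[OF K]] Df c]
      unfolding K_Suc by blast
    have "\<exists>w\<in>module_ideal_prod V I. f' u = g u \<oplus>\<^bsub>V\<^esub> w" if u: "u \<in> carrier V" for u
    proof -
      obtain w w' where w: "w \<in> module_ideal_prod V I" "f u = g u \<oplus>\<^bsub>V\<^esub> w"
        and w': "w' \<in> module_ideal_prod V (K n)" "f' u = f u \<oplus>\<^bsub>V\<^esub> w'"
        using fg[OF u] ff'[OF u] by blast
      have w'I: "w' \<in> module_ideal_prod V I"
        using module_ideal_prod_mono[of "K n" I] K w'(1) by blast
      have "f' u = g u \<oplus>\<^bsub>V\<^esub> (w \<oplus>\<^bsub>V\<^esub> w')"
        using w(2) w'(2) linear_mapsD(1)[OF g u] module_ideal_prod_carrier[OF II] w(1) w'I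
        by (simp add: V.a_assoc)
      then show ?thesis using module_ideal_prod_add[OF w(1) w'I] by blast
    qed
    then show ?case using f' Df' by blast
  qed
  from all[of n] obtain f where f: "f \<in> linear_maps A V V"
    and Df: "\<forall>u\<in>carrier V. \<forall>v\<in>carrier V. defect f u v \<in> K n"
    and fg: "\<forall>u\<in>carrier V. \<exists>w\<in>module_ideal_prod V I. f u = g u \<oplus>\<^bsub>V\<^esub> w"
    by (elim bexE conjE)
  have iso: "h (f u) (f v) = h u v" if "u \<in> carrier V" "v \<in> carrier V" for u v
  proof -
    have "defect f u v = \<zero>\<^bsub>A\<^esub>" using Df that Kn by blast
    then show ?thesis using h_map_eq[OF f that] h_closed[OF that] by simp
  qed
  show thesis by (rule that[OF f iso]) (use fg in auto)
qed

end

section \<open>Reduction modulo an ideal\<close>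

locale reduction = hermitian_space A star V h m
  for A :: "('a, 'c) ring_scheme" (structure) and star
    and V :: "('a, 'b, 'd) module_scheme" (structure) and h m +
  fixes I :: "'a set"
  assumes ideal: "ideal I A" and star_I: "star ` I \<subseteq> I"
begin

abbreviation N :: "'b set" where "N \<equiv> module_ideal_prod V I"
abbreviation red :: "('a set, 'b set) module" where "red \<equiv> reduced_module V I"

lemmas N_carrier = module_ideal_prod_carrier[OF ideal]

lemma N_subgroup: "abelian_subgroup N V"
  by (rule abelian_subgroupI3)
    (auto simp: additive_subgroup_def module_ideal_prod_subgroup[OF ideal] V.abelian_group_axioms)

lemma mem_coset: "x \<in> N +>\<^bsub>V\<^esub> v \<longleftrightarrow> (\<exists>w\<in>N. x = w \<oplus>\<^bsub>V\<^esub> v)"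
  by (auto simp: a_r_coset_def')

lemma mem_ideal_coset: "x \<in> I +>\<^bsub>A\<^esub> a \<longleftrightarrow> (\<exists>i\<in>I. x = i \<oplus>\<^bsub>A\<^esub> a)"
  by (auto simp: a_r_coset_def')

lemma coset_eq_iff:
  assumes "u \<in> carrier V" "v \<in> carrier V"
  shows "N +>\<^bsub>V\<^esub> u = N +>\<^bsub>V\<^esub> v \<longleftrightarrow> (\<exists>w\<in>N. u = v \<oplus>\<^bsub>V\<^esub> w)"
proof
  assume "N +>\<^bsub>V\<^esub> u = N +>\<^bsub>V\<^esub> v"
  then have "u \<in> N +>\<^bsub>V\<^esub> v" using abelian_subgroup.a_rcos_self[OF N_subgroup assms(1)] by simp
  then show "\<exists>w\<in>N. u = v \<oplus>\<^bsub>V\<^esub> w" using N_carrier assms(2) by (auto simp: mem_coset V.a_comm)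
next
  assume "\<exists>w\<in>N. u = v \<oplus>\<^bsub>V\<^esub> w"
  then have "u \<in> N +>\<^bsub>V\<^esub> v" using N_carrier assms(2) by (auto simp: mem_coset V.a_comm)
  then show "N +>\<^bsub>V\<^esub> u = N +>\<^bsub>V\<^esub> v"
    using V.a_repr_independence[OF _ assms(2) module_ideal_prod_subgroup[OF ideal]] by simp
qed

lemma coset_shift: "v \<in> carrier V \<Longrightarrow> w \<in> N \<Longrightarrow> N +>\<^bsub>V\<^esub> (v \<oplus>\<^bsub>V\<^esub> w) = N +>\<^bsub>V\<^esub> v"
  using coset_eq_iff[of "v \<oplus>\<^bsub>V\<^esub> w" v] N_carrier by auto

lemma ideal_coset_shift: "a \<in> carrier A \<Longrightarrow> i \<in> I \<Longrightarrow> I +>\<^bsub>A\<^esub> (i \<oplus>\<^bsub>A\<^esub> a) = I +>\<^bsub>A\<^esub> a"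
proof -
  assume a: "a \<in> carrier A" and i: "i \<in> I"
  interpret I: ideal I A by (rule ideal)
  have "i \<oplus>\<^bsub>A\<^esub> a \<in> I +>\<^bsub>A\<^esub> a" using i by (auto simp: mem_ideal_coset)
  then show ?thesis using I.a_repr_independence' a by simp
qed

lemma red_carrier: "carrier red = (\<lambda>v. N +>\<^bsub>V\<^esub> v) ` carrier V"
  by (auto simp: reduced_module_def A_RCOSETS_def')

lemma red_add:
  "u \<in> carrier V \<Longrightarrow> v \<in> carrier V \<Longrightarrow>
     (N +>\<^bsub>V\<^esub> u) \<oplus>\<^bsub>red\<^esub> (N +>\<^bsub>V\<^esub> v) = N +>\<^bsub>V\<^esub> (u \<oplus>\<^bsub>V\<^esub> v)"
  using abelian_subgroup.a_rcos_sum[OF N_subgroup] by (simp add: reduced_module_def)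

lemma quot_carrier: "carrier (A Quot I) = (\<lambda>a. I +>\<^bsub>A\<^esub> a) ` carrier A"
  by (auto simp: FactRing_def A_RCOSETS_def')

text \<open>The operations and maps on the reduction are unions over all representatives; each member of the
  union is the same coset, so one representative determines the value.\<close>
lemma red_smult:
  assumes a: "a \<in> carrier A" and v: "v \<in> carrier V"
  shows "(I +>\<^bsub>A\<^esub> a) \<odot>\<^bsub>red\<^esub> (N +>\<^bsub>V\<^esub> v) = N +>\<^bsub>V\<^esub> (a \<odot>\<^bsub>V\<^esub> v)"
proof -
  have eq: "N +>\<^bsub>V\<^esub> (b \<odot>\<^bsub>V\<^esub> w) = N +>\<^bsub>V\<^esub> (a \<odot>\<^bsub>V\<^esub> v)"
    if b: "b \<in> I +>\<^bsub>A\<^esub> a" and w: "w \<in> N +>\<^bsub>V\<^esub> v" for b w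
  proof -
    obtain i n where i: "i \<in> I" "b = i \<oplus>\<^bsub>A\<^esub> a" and n: "n \<in> N" "w = n \<oplus>\<^bsub>V\<^esub> v"
      using b w by (auto simp: mem_coset mem_ideal_coset)
    have ic: "i \<in> carrier A" and nc: "n \<in> carrier V"
      using ideal.Icarr[OF ideal i(1)] N_carrier[OF n(1)] .
    have "b \<odot>\<^bsub>V\<^esub> w = a \<odot>\<^bsub>V\<^esub> v \<oplus>\<^bsub>V\<^esub> (i \<odot>\<^bsub>V\<^esub> (n \<oplus>\<^bsub>V\<^esub> v) \<oplus>\<^bsub>V\<^esub> a \<odot>\<^bsub>V\<^esub> n)"
      using ic nc a v act_closed by (simp add: i n act_add_scalar act_add_vector V.add.m_ac)
    moreover have "i \<odot>\<^bsub>V\<^esub> (n \<oplus>\<^bsub>V\<^esub> v) \<oplus>\<^bsub>V\<^esub> a \<odot>\<^bsub>V\<^esub> n \<in> N"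
      using module_ideal_prod_act[OF i(1)] module_ideal_prod_act_closed[OF ideal n(1) a] nc v
      by (intro module_ideal_prod_add) auto
    ultimately show ?thesis using coset_shift act_closed a v by simp
  qed
  have a0: "a \<in> I +>\<^bsub>A\<^esub> a"
    using a additive_subgroup.zero_closed[OF ideal.axioms(1)[OF ideal]]
    by (auto simp: mem_ideal_coset intro!: bexI[of _ "\<zero>\<^bsub>A\<^esub>"])
  have v0: "v \<in> N +>\<^bsub>V\<^esub> v" by (rule abelian_subgroup.a_rcos_self[OF N_subgroup v])
  have "(\<Union>w\<in>N +>\<^bsub>V\<^esub> v. N +>\<^bsub>V\<^esub> (b \<odot>\<^bsub>V\<^esub> w)) = N +>\<^bsub>V\<^esub> (a \<odot>\<^bsub>V\<^esub> v)"
    if "b \<in> I +>\<^bsub>A\<^esub> a" for b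
    by (rule UN_constant_eq[OF v0]) (use eq that in blast)
  then have "(\<Union>b\<in>I +>\<^bsub>A\<^esub> a. \<Union>w\<in>N +>\<^bsub>V\<^esub> v. N +>\<^bsub>V\<^esub> (b \<odot>\<^bsub>V\<^esub> w)) = N +>\<^bsub>V\<^esub> (a \<odot>\<^bsub>V\<^esub> v)"
    by (intro UN_constant_eq[OF a0]) blast
  then show ?thesis by (simp add: reduced_module_def)
qed

lemma red_form:
  assumes u: "u \<in> carrier V" and v: "v \<in> carrier V"
  shows "reduced_form A I h (N +>\<^bsub>V\<^esub> u) (N +>\<^bsub>V\<^esub> v) = I +>\<^bsub>A\<^esub> h u v"
proof -
  have eq: "I +>\<^bsub>A\<^esub> h x y = I +>\<^bsub>A\<^esub> h u v" if x: "x \<in> N +>\<^bsub>V\<^esub> u" and y: "y \<in> N +>\<^bsub>V\<^esub> v" for x y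
  proof -
    obtain w w' where w: "w \<in> N" "x = w \<oplus>\<^bsub>V\<^esub> u" and w': "w' \<in> N" "y = w' \<oplus>\<^bsub>V\<^esub> v"
      using x y by (auto simp: mem_coset)
    note wc = N_carrier[OF w(1)] N_carrier[OF w'(1)]
    have "h x y = h w y \<oplus>\<^bsub>A\<^esub> (h u w' \<oplus>\<^bsub>A\<^esub> h u v)"
    proof -
      have "h x y = h w y \<oplus>\<^bsub>A\<^esub> h u y"
        using wc u v w'(2) by (simp add: w(2) h_add_left)
      also have "h u y = h u w' \<oplus>\<^bsub>A\<^esub> h u v"
        using wc u v by (simp add: w'(2) h_add_right)
      finally show ?thesis .
    qed
    moreover have "h w y \<in> I"
      by (rule h_module_ideal_prod_left[OF ideal star_I _ w(1)]) (use wc w' v in auto)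
    moreover have "h u w' \<in> I" by (rule h_module_ideal_prod_right[OF ideal u w'(1)])
    ultimately show ?thesis
      using ideal_coset_shift h_closed u v wc by simp
  qed
  note self = abelian_subgroup.a_rcos_self[OF N_subgroup]
  have "(\<Union>y\<in>N +>\<^bsub>V\<^esub> v. I +>\<^bsub>A\<^esub> h x y) = I +>\<^bsub>A\<^esub> h u v" if "x \<in> N +>\<^bsub>V\<^esub> u" for x
    by (rule UN_constant_eq[OF self[OF v]]) (use eq that in blast)
  then show ?thesis
    unfolding reduced_form_def by (intro UN_constant_eq[OF self[OF u]]) blast
qed

lemma red_map:
  assumes g: "g \<in> linear_maps A V V" and v: "v \<in> carrier V"
  shows "reduced_map V I g (N +>\<^bsub>V\<^esub> v) = N +>\<^bsub>V\<^esub> g v"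
proof -
  have "(\<Union>x\<in>N +>\<^bsub>V\<^esub> v. N +>\<^bsub>V\<^esub> g x) = N +>\<^bsub>V\<^esub> g v"
  proof (rule UN_constant_eq)
    show "v \<in> N +>\<^bsub>V\<^esub> v" by (rule abelian_subgroup.a_rcos_self[OF N_subgroup v])
    show "\<forall>x\<in>N +>\<^bsub>V\<^esub> v. N +>\<^bsub>V\<^esub> g x = N +>\<^bsub>V\<^esub> g v"
    proof
      fix x assume "x \<in> N +>\<^bsub>V\<^esub> v"
      then obtain w where w: "w \<in> N" "x = w \<oplus>\<^bsub>V\<^esub> v" by (auto simp: mem_coset)
      then have "g x = g v \<oplus>\<^bsub>V\<^esub> g w"
        using linear_mapsD(1,2)[OF g] N_carrier v by (simp add: V.a_comm)
      then show "N +>\<^bsub>V\<^esub> g x = N +>\<^bsub>V\<^esub> g v"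
        using coset_shift linear_map_module_ideal_prod[OF g ideal w(1)] linear_mapsD(1)[OF g v] by simp
    qed
  qed
  then show ?thesis using v by (simp add: reduced_map_def red_carrier)
qed

lemma red_map_linear:
  assumes g: "g \<in> linear_maps A V V"
  shows "reduced_map V I g \<in> linear_maps (A Quot I) red red"
proof -
  note gD = linear_mapsD[OF g]
  have "reduced_map V I g \<in> carrier red \<rightarrow>\<^sub>E carrier red"
    using red_map[OF g] gD(1) by (auto simp: red_carrier PiE_iff) (simp add: reduced_map_def red_carrier)
  then show ?thesis
    unfolding linear_maps_def using red_map[OF g] gD red_add red_smult act_closed
    by (auto simp: red_carrier quot_carrier)
qed

lemma red_map_compose:
  assumes "f \<in> linear_maps A V V" "g \<in> linear_maps A V V" "compose (carrier V) f g \<in> linear_maps A V V"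
  shows "reduced_map V I (compose (carrier V) f g)
    = compose (carrier red) (reduced_map V I f) (reduced_map V I g)"
proof (rule extensionalityI)
  show "reduced_map V I (compose (carrier V) f g) \<in> extensional (carrier red)"
    by (simp add: reduced_map_def)
  show "compose (carrier red) (reduced_map V I f) (reduced_map V I g) \<in> extensional (carrier red)"
    by simp
  fix X assume "X \<in> carrier red"
  then obtain v where "X = N +>\<^bsub>V\<^esub> v" "v \<in> carrier V" by (auto simp: red_carrier)
  then show "reduced_map V I (compose (carrier V) f g) X
      = compose (carrier red) (reduced_map V I f) (reduced_map V I g) X"
    using assms linear_mapsD(1)[OF assms(2)] by (simp add: red_map compose_def red_carrier)
qed

text \<open>Injectivity holds because \<open>g\<close> maps \<open>V I\<close> onto itself: a generator \<open>v a\<close> with \<open>v = g u\<close> is the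
  image of \<open>u a\<close>.\<close>
lemma red_map_Bij:
  assumes g: "g \<in> linear_maps A V V" and surj: "g ` carrier V = carrier V"
    and inj: "inj_on g (carrier V)"
  shows "reduced_map V I g \<in> Bij (carrier red)"
proof -
  note gD = linear_mapsD[OF g]
  have gN: "\<exists>x\<in>N. w = g x" if "w \<in> N" for w
    using ideal that
  proof (induction rule: module_ideal_prod_induct)
    case zero
    show ?case using linear_map_zero[OF g] module_ideal_prod_zero by force
  next
    case (act a v)
    then obtain u where "u \<in> carrier V" "v = g u" using surj by blast
    then show ?case
      using gD(3)[OF ideal.Icarr[OF ideal act(1)]] module_ideal_prod_act[OF act(1)] by metis
  next
    case (add v w)
    then show ?case using gD(2) N_carrier module_ideal_prod_add by metis
  qed
  have "inj_on (reduced_map V I g) (carrier red)"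
  proof (rule inj_onI)
    fix X Y assume "X \<in> carrier red" "Y \<in> carrier red" and eq: "reduced_map V I g X = reduced_map V I g Y"
    then obtain u v where u: "u \<in> carrier V" "X = N +>\<^bsub>V\<^esub> u" and v: "v \<in> carrier V" "Y = N +>\<^bsub>V\<^esub> v"
      by (auto simp: red_carrier)
    then have "\<exists>w\<in>N. g u = g v \<oplus>\<^bsub>V\<^esub> w"
      using eq red_map[OF g] coset_eq_iff gD(1) by simp
    then obtain x where x: "x \<in> N" "g u = g v \<oplus>\<^bsub>V\<^esub> g x" using gN by blast
    then have "g u = g (v \<oplus>\<^bsub>V\<^esub> x)" using gD(2) v(1) N_carrier by simp
    then have "u = v \<oplus>\<^bsub>V\<^esub> x" using inj u(1) v(1) N_carrier[OF x(1)] by (auto dest: inj_onD)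
    then show "X = Y" using u v x(1) coset_shift by simp
  qed
  moreover have "reduced_map V I g ` carrier red = carrier red"
  proof -
    have "reduced_map V I g ` carrier red = (\<lambda>v. N +>\<^bsub>V\<^esub> v) ` g ` carrier V"
      using red_map[OF g] by (auto simp: red_carrier image_image)
    then show ?thesis using surj by (simp add: red_carrier)
  qed
  ultimately show ?thesis
    by (simp add: Bij_def bij_betw_def) (simp add: reduced_map_def)
qed

text \<open>Lift the images of a basis arbitrarily and extend linearly. Both \<open>G\<close> and the reduction of the
  extension are linear and agree on the basis.\<close>
lemma linear_lift:
  assumes G: "G \<in> linear_maps (A Quot I) red red"
  obtains g where "g \<in> linear_maps A V V"
    and "\<And>v. v \<in> carrier V \<Longrightarrow> G (N +>\<^bsub>V\<^esub> v) = N +>\<^bsub>V\<^esub> g v"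
proof -
  have G_closed: "G (N +>\<^bsub>V\<^esub> v) \<in> (\<lambda>v. N +>\<^bsub>V\<^esub> v) ` carrier V" if "v \<in> carrier V" for v
    using G that by (auto simp: linear_maps_def red_carrier)
  have G_add: "G (N +>\<^bsub>V\<^esub> (u \<oplus>\<^bsub>V\<^esub> v)) = G (N +>\<^bsub>V\<^esub> u) \<oplus>\<^bsub>red\<^esub> G (N +>\<^bsub>V\<^esub> v)"
    if "u \<in> carrier V" "v \<in> carrier V" for u v
    using G that by (auto simp: linear_maps_def red_carrier red_add)
  have G_act: "G (N +>\<^bsub>V\<^esub> (a \<odot>\<^bsub>V\<^esub> v)) = (I +>\<^bsub>A\<^esub> a) \<odot>\<^bsub>red\<^esub> G (N +>\<^bsub>V\<^esub> v)"
    if "a \<in> carrier A" "v \<in> carrier V" for a v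
    using G that by (auto simp: linear_maps_def red_carrier quot_carrier red_smult[symmetric])
  obtain e c where e: "\<And>i. i < m \<Longrightarrow> e i \<in> carrier V"
    and c: "\<And>i. i < m \<Longrightarrow> c i \<in> linear_maps A V (regular_module A)"
    and expand: "\<And>v. v \<in> carrier V \<Longrightarrow> v = (\<Oplus>\<^bsub>V\<^esub>i\<in>{..<m}. c i v \<odot>\<^bsub>V\<^esub> e i)"
    by (rule free_coordinates[OF free]) blast
  have "\<forall>i\<in>{..<m}. \<exists>r\<in>carrier V. G (N +>\<^bsub>V\<^esub> e i) = N +>\<^bsub>V\<^esub> r"
    using G_closed[OF e] by (auto simp: image_iff Bex_def)
  then obtain r where r: "\<And>i. i < m \<Longrightarrow> r i \<in> carrier V"
    "\<And>i. i < m \<Longrightarrow> G (N +>\<^bsub>V\<^esub> e i) = N +>\<^bsub>V\<^esub> r i"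
    by (metis lessThan_iff)
  define g where "g = (\<lambda>v\<in>carrier V. \<Oplus>\<^bsub>V\<^esub>i\<in>{..<m}. c i v \<odot>\<^bsub>V\<^esub> r i)"
  have lift: "G (N +>\<^bsub>V\<^esub> v) = N +>\<^bsub>V\<^esub> g v" if v: "v \<in> carrier V" for v
  proof -
    have sums: "G (N +>\<^bsub>V\<^esub> (\<Oplus>\<^bsub>V\<^esub>i\<in>F. c i v \<odot>\<^bsub>V\<^esub> e i)) = N +>\<^bsub>V\<^esub> (\<Oplus>\<^bsub>V\<^esub>i\<in>F. c i v \<odot>\<^bsub>V\<^esub> r i)"
      if "finite F" "F \<subseteq> {..<m}" for F
      using that
    proof (induction rule: finite_induct)
      \<comment> \<open>The coset of \<open>\<zero>\<close> is the product of any coset with the scalar \<open>\<zero>\<close>.\<close>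
      case empty
      obtain x where x: "x \<in> carrier V" "G (N +>\<^bsub>V\<^esub> \<zero>\<^bsub>V\<^esub>) = N +>\<^bsub>V\<^esub> x"
        using G_closed[of "\<zero>\<^bsub>V\<^esub>"] by auto
      have "G (N +>\<^bsub>V\<^esub> \<zero>\<^bsub>V\<^esub>) = N +>\<^bsub>V\<^esub> \<zero>\<^bsub>V\<^esub>"
        using G_act[of "\<zero>\<^bsub>A\<^esub>" "\<zero>\<^bsub>V\<^esub>"] x red_smult[of "\<zero>\<^bsub>A\<^esub>" x] by (simp add: zero_act)
      then show ?case by simp
    next
      case (insert i F)
      have terms: "c j v \<odot>\<^bsub>V\<^esub> e j \<in> carrier V" "c j v \<odot>\<^bsub>V\<^esub> r j \<in> carrier V" if "j \<in> insert i F" for j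
        using that insert.prems functionalD(1)[OF c v] e r(1) act_closed by auto
      then have sums: "(\<Oplus>\<^bsub>V\<^esub>i\<in>F. c i v \<odot>\<^bsub>V\<^esub> e i) \<in> carrier V" "(\<Oplus>\<^bsub>V\<^esub>i\<in>F. c i v \<odot>\<^bsub>V\<^esub> r i) \<in> carrier V"
        by (auto intro!: V.finsum_closed)
      have "G (N +>\<^bsub>V\<^esub> (c i v \<odot>\<^bsub>V\<^esub> e i)) = N +>\<^bsub>V\<^esub> (c i v \<odot>\<^bsub>V\<^esub> r i)"
        using insert.prems G_act functionalD(1)[OF c v] e r red_smult by simp
      then show ?case
        using insert terms sums G_add red_add by (simp add: Pi_iff)
    qed
    show ?thesis using sums[of "{..<m}"] expand[OF v] v by (simp add: g_def)
  qed
  have "g \<in> linear_maps A V V"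
    unfolding g_def by (rule combination_linear) (use c r(1) in auto)
  then show thesis using lift by (rule that)
qed

lemma unitary_carrier:
  "f \<in> carrier (unitary_group B W k) \<longleftrightarrow> f \<in> Bij (carrier W) \<and> f \<in> linear_maps B W W \<and>
     (\<forall>u\<in>carrier W. \<forall>v\<in>carrier W. k (f u) (f v) = k u v)"
  by (auto simp: unitary_group_def)

lemma red_map_unitary:
  assumes g: "g \<in> carrier (unitary_group A V h)"
  shows "reduced_map V I g \<in> carrier (unitary_group (A Quot I) red (reduced_form A I h))"
proof -
  have lin: "g \<in> linear_maps A V V" and bij: "bij_betw g (carrier V) (carrier V)"
    and iso: "\<And>u v. u \<in> carrier V \<Longrightarrow> v \<in> carrier V \<Longrightarrow> h (g u) (g v) = h u v"
    using g by (auto simp: unitary_carrier Bij_def)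
  have "reduced_form A I h (reduced_map V I g X) (reduced_map V I g Y) = reduced_form A I h X Y"
    if X: "X \<in> carrier red" and Y: "Y \<in> carrier red" for X Y
  proof -
    obtain u v where "X = N +>\<^bsub>V\<^esub> u" "Y = N +>\<^bsub>V\<^esub> v" "u \<in> carrier V" "v \<in> carrier V"
      using X Y by (auto simp: red_carrier)
    then show ?thesis using iso linear_mapsD(1)[OF lin] by (simp add: red_map[OF lin] red_form)
  qed
  then show ?thesis
    using red_map_linear[OF lin] red_map_Bij[OF lin] bij by (simp add: unitary_carrier bij_betw_def)
qed

end

lemma unitary_mult:
  assumes "f \<in> carrier (unitary_group B W k)" "g \<in> carrier (unitary_group B W k)"
  shows "f \<otimes>\<^bsub>unitary_group B W k\<^esub> g = compose (carrier W) f g"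
  using assms by (simp add: unitary_group_def BijGroup_def)

lemma (in reduction) red_map_hom:
  "reduced_map V I \<in> hom (unitary_group A V h) (unitary_group (A Quot I) red (reduced_form A I h))"
proof (rule homI)
  fix f g assume f: "f \<in> carrier (unitary_group A V h)" and g: "g \<in> carrier (unitary_group A V h)"
  have fl: "f \<in> linear_maps A V V" and gl: "g \<in> linear_maps A V V"
    using f g by (auto simp: unitary_carrier)
  have "compose (carrier V) f g \<in> linear_maps A V V"
    using linear_mapsD[OF fl] linear_mapsD[OF gl] act_closed
    by (auto simp: linear_maps_def compose_def)
  then show "reduced_map V I (f \<otimes>\<^bsub>unitary_group A V h\<^esub> g)
      = reduced_map V I f \<otimes>\<^bsub>unitary_group (A Quot I) red (reduced_form A I h)\<^esub> reduced_map V I g"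
    using unitary_mult[OF f g] unitary_mult[OF red_map_unitary[OF f] red_map_unitary[OF g]]
      red_map_compose[OF fl gl] by simp
qed (rule red_map_unitary)

text \<open>A linear lift of \<open>G\<close> preserves \<open>h\<close> modulo \<open>I\<close>, so there is an isometry \<open>f\<close> with the same
  reduction. An isometry is injective as \<open>h\<close> is nondegenerate, and \<open>f\<close> is surjective because its
  reduction \<open>G\<close> is.\<close>
lemma (in reduction) unitary_lift:
  assumes nil: "nilpotent_ideal I A"
    and c: "c \<in> carrier A" "star c = c" "c \<oplus>\<^bsub>A\<^esub> c = \<one>\<^bsub>A\<^esub>"
      "\<And>a. a \<in> carrier A \<Longrightarrow> c \<otimes>\<^bsub>A\<^esub> a = a \<otimes>\<^bsub>A\<^esub> c"
    and G: "G \<in> carrier (unitary_group (A Quot I) red (reduced_form A I h))"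
  shows "G \<in> reduced_map V I ` carrier (unitary_group A V h)"
proof -
  have Gl: "G \<in> linear_maps (A Quot I) red red"
    and Gb: "G ` carrier red = carrier red"
    and Gi: "\<And>X Y. X \<in> carrier red \<Longrightarrow> Y \<in> carrier red \<Longrightarrow>
        reduced_form A I h (G X) (G Y) = reduced_form A I h X Y"
    using G by (auto simp: unitary_carrier Bij_def bij_betw_def)
  obtain g where g: "g \<in> linear_maps A V V"
    and Gg: "\<And>v. v \<in> carrier V \<Longrightarrow> G (N +>\<^bsub>V\<^esub> v) = N +>\<^bsub>V\<^esub> g v"
    by (rule linear_lift[OF Gl]) blast
  interpret I: ideal I A by (rule ideal)
  have "defect g u v \<in> I" if u: "u \<in> carrier V" and v: "v \<in> carrier V" for u v
  proof -
    have gc: "h (g u) (g v) \<in> carrier A" using h_closed linear_mapsD(1)[OF g] u v by simp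
    have "I +>\<^bsub>A\<^esub> h (g u) (g v) = I +>\<^bsub>A\<^esub> h u v"
      using Gi[of "N +>\<^bsub>V\<^esub> u" "N +>\<^bsub>V\<^esub> v"] u v Gg linear_mapsD(1)[OF g] by (simp add: red_form red_carrier)
    then have "h (g u) (g v) \<in> I +>\<^bsub>A\<^esub> h u v" using I.a_rcos_self[OF gc] by simp
    then show ?thesis
      using I.a_rcos_module_minus[OF ring_axioms h_closed[OF u v] gc] by (simp add: defect_def)
  qed
  then obtain f where f: "f \<in> linear_maps A V V"
    and iso: "\<And>u v. u \<in> carrier V \<Longrightarrow> v \<in> carrier V \<Longrightarrow> h (f u) (f v) = h u v"
    and fg: "\<And>u. u \<in> carrier V \<Longrightarrow> \<exists>w\<in>N. f u = g u \<oplus>\<^bsub>V\<^esub> w"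
    using isometry_near[OF nil star_I c g] by blast
  note fD = linear_mapsD[OF f]
  have Gf: "G (N +>\<^bsub>V\<^esub> v) = N +>\<^bsub>V\<^esub> f v" if "v \<in> carrier V" for v
    using fg[OF that] Gg[OF that] coset_shift linear_mapsD(1)[OF g that] by auto
  have surj: "f ` carrier V = carrier V"
  proof (rule surjective_of_surjective_mod[OF nil f])
    fix v assume v: "v \<in> carrier V"
    then have "N +>\<^bsub>V\<^esub> v \<in> G ` carrier red" using Gb by (simp add: red_carrier)
    then obtain u where u: "u \<in> carrier V" "N +>\<^bsub>V\<^esub> v = N +>\<^bsub>V\<^esub> f u" using Gf by (auto simp: red_carrier)
    then show "\<exists>u\<in>carrier V. \<exists>w\<in>N. v = f u \<oplus>\<^bsub>V\<^esub> w"
      using coset_eq_iff[OF v fD(1)[OF u(1)]] by auto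
  qed
  have inj: "inj_on f (carrier V)"
  proof (rule inj_onI)
    fix u v assume uv: "u \<in> carrier V" "v \<in> carrier V" "f u = f v"
    show "u = v" by (rule h_left_cancel[OF uv(1,2)]) (use iso uv in metis)
  qed
  have "f \<in> carrier (unitary_group A V h)"
    using f iso surj inj fD(4) by (simp add: unitary_carrier Bij_def bij_betw_def)
  moreover have "G = reduced_map V I f"
  proof (rule extensionalityI)
    show "G \<in> extensional (carrier red)" using Gl by (auto simp: linear_maps_def PiE_def)
    show "reduced_map V I f \<in> extensional (carrier red)" by (simp add: reduced_map_def)
    show "G X = reduced_map V I f X" if "X \<in> carrier red" for X
      using that Gf red_map[OF f] by (auto simp: red_carrier)
  qed
  ultimately show ?thesis by blast
qed

section \<open>Surjectivity of the reduction homomorphism\<close>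

theorem theorem5p2:
  fixes A :: "('a, 'c) ring_scheme" and star :: "'a \<Rightarrow> 'a"
    and V :: "('a, 'b, 'd) module_scheme" and h :: "'b \<Rightarrow> 'b \<Rightarrow> 'a" and m :: nat
    and I :: "'a set"
  assumes "local_involution_ring A star"
    and "hermitian_space A star V h m"
    and "nilpotent_ideal I A"
    and "star ` I \<subseteq> I"
  shows "reduced_map V I \<in>
    epi (unitary_group A V h)
        (unitary_group (A Quot I) (reduced_module V I) (reduced_form A I h))"
proof -
  interpret reduction A star V h m I
    using assms by (intro reduction.intro reduction_axioms.intro) (auto simp: nilpotent_ideal_def)
  obtain c where "c \<in> carrier A" "star c = c" "c \<oplus>\<^bsub>A\<^esub> c = \<one>\<^bsub>A\<^esub>"
    "\<And>a. a \<in> carrier A \<Longrightarrow> c \<otimes>\<^bsub>A\<^esub> a = a \<otimes>\<^bsub>A\<^esub> c"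
    by (rule local_involution_ring.central_half[OF assms(1)]) blast
  then show ?thesis
    using red_map_hom unitary_lift[OF assms(3)] red_map_unitary by (auto simp: epi_def)
qed

end
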